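(* Let $M$ be a complex manifold endowed with a distance $d$ and let $U\subset M$ be an arbitrary Stein domain. Let $\mu$ be a regular Borel measure on $M$ and $\nu$ a regular Borel measure on $\partial U$. Let $\psi$ be a Borel measurable function on $\partial U$ whose restriction to some closed subset $S\subset\partial U$ is continuous. Then there exist a holomorphic function $f$ on $U$ and a set $F\subset\partial U$, with $S\subset F$ and $\nu(\partial U\setminus F)=0$, such that, for every $p\in F$, there is a set $\mathcal F_p\subset U$ such that $$f(x)\to\psi(p)\quad\text{as}\quad x\to p,\ x\in\mathcal F_p,$$ and, for every $\epsilon>0$, there is an $r_{p,\epsilon}>0$ such that $$\mu\big(\mathbb B(p,r)\cap(U\setminus\mathcal F_p)\big)\le\epsilon\cdot\mu\big(\mathbb B(p,r)\cap U\big)\quad\text{for all }0<r<r_{p,\epsilon}.$$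
   Context: A complex manifold means a connected holomorphic manifold. A distance on $M$ is a metric inducing the manifold topology. Every domain $U\subset M$ is itself a complex manifold, and $U$ is called a Stein domain if it is a Stein manifold. $\partial U$ is the boundary of $U$ in $M$. $\mathbb B(p,r)=\{x\in M: d(x,p)<r\}$. By definition, a Borel measure is (positive and) finite on compact sets. Functions are complex-valued. *)

theory Defs
  imports "HOL-Analysis.Analysis"
begin

text \<open>
  The underlying set of the manifold \<open>M\<close> is a type of class \<^class>\<open>metric_space\<close>: the manifold
  topology is the topology of the type, and \<open>d\<close> is \<^const>\<open>dist\<close>, which induces it by the class
  axioms.  Hausdorffness is therefore automatic, and so is second countability, since a connected
  metrizable locally Euclidean space is second countable.  The complex structure is given by a
  holomorphic atlas (not necessarily maximal).
\<close>

type_synonym ('a, 'n) chart = "'a set \<times> ('a \<Rightarrow> complex ^ 'n)"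

text \<open>
  Holomorphy of a function of several complex variables on an open set \<open>S\<close>: the Frechet derivative
  exists at each point and is complex linear.
\<close>

definition holomorphic_Cn_on :: "(complex ^ 'n::finite \<Rightarrow> complex) \<Rightarrow> (complex ^ 'n) set \<Rightarrow> bool" where
  "holomorphic_Cn_on f S \<longleftrightarrow>
     (\<forall>z\<in>S. \<exists>D. (f has_derivative D) (at z) \<and> (\<forall>c v. D (c *s v) = c * D v))"

definition is_chart :: "('a::metric_space, 'n::finite) chart \<Rightarrow> bool" where
  "is_chart = (\<lambda>(V, \<phi>). open V \<and> open (\<phi> ` V) \<and> homeomorphism V (\<phi> ` V) \<phi> (inv_into V \<phi>))"

definition holomorphic_transition :: "('a, 'n::finite) chart \<Rightarrow> ('a, 'n) chart \<Rightarrow> bool" where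
  "holomorphic_transition = (\<lambda>(V, \<phi>) (W, \<theta>).
     \<forall>i. holomorphic_Cn_on (\<lambda>z. \<theta> (inv_into V \<phi> z) $ i) (\<phi> ` (V \<inter> W)))"

definition complex_atlas :: "('a::metric_space, 'n::finite) chart set \<Rightarrow> bool" where
  "complex_atlas A \<longleftrightarrow>
     (\<forall>c\<in>A. is_chart c) \<and>
     (\<Union>c\<in>A. fst c) = UNIV \<and>
     (\<forall>c\<in>A. \<forall>c'\<in>A. holomorphic_transition c c')"

text \<open>
  A connected complex manifold has constant dimension.  Dimension \<open>n \<ge> 1\<close> is the first disjunct,
  with \<open>n = CARD('n)\<close>.  Index types are nonempty, so \<open>complex ^ 'n\<close> cannot be a zero-dimensional
  model; a connected zero-dimensional manifold is a single point and is represented by the empty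
  atlas, for which all chart conditions below are vacuous, as they should be in dimension zero.
\<close>

definition complex_manifold :: "('a::metric_space, 'n::finite) chart set \<Rightarrow> bool" where
  "complex_manifold A \<longleftrightarrow>
     connected (UNIV :: 'a set) \<and>
     (complex_atlas A \<or> (A = {} \<and> (\<exists>p. (UNIV :: 'a set) = {p})))"

definition holomorphic_fun_on ::
  "('a::metric_space, 'n::finite) chart set \<Rightarrow> ('a \<Rightarrow> complex) \<Rightarrow> 'a set \<Rightarrow> bool" where
  "holomorphic_fun_on A f U \<longleftrightarrow>
     (\<forall>(V, \<phi>)\<in>A. holomorphic_Cn_on (\<lambda>z. f (inv_into V \<phi> z)) (\<phi> ` (V \<inter> U)))"

definition holomorphic_hull ::
  "('a::metric_space, 'n::finite) chart set \<Rightarrow> 'a set \<Rightarrow> 'a set \<Rightarrow> 'a set" where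
  "holomorphic_hull A U K =
     {x \<in> U. \<forall>f. holomorphic_fun_on A f U \<longrightarrow> cmod (f x) \<le> (SUP y\<in>K. cmod (f y))}"

definition holomorphically_convex :: "('a::metric_space, 'n::finite) chart set \<Rightarrow> 'a set \<Rightarrow> bool" where
  "holomorphically_convex A U \<longleftrightarrow> (\<forall>K\<subseteq>U. compact K \<longrightarrow> compact (holomorphic_hull A U K))"

definition holomorphically_separable :: "('a::metric_space, 'n::finite) chart set \<Rightarrow> 'a set \<Rightarrow> bool" where
  "holomorphically_separable A U \<longleftrightarrow>
     (\<forall>x\<in>U. \<forall>y\<in>U. x \<noteq> y \<longrightarrow> (\<exists>f. holomorphic_fun_on A f U \<and> f x \<noteq> f y))"

text \<open>
  Each point has \<open>n\<close> global holomorphic functions on \<open>U\<close>, collected in \<open>g\<close>, that form a coordinate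
  system at the point, i.e. whose differentials there are linearly independent.
\<close>

definition global_local_coordinates :: "('a::metric_space, 'n::finite) chart set \<Rightarrow> 'a set \<Rightarrow> bool" where
  "global_local_coordinates A U \<longleftrightarrow>
     (\<forall>p\<in>U. \<exists>g :: 'a \<Rightarrow> complex ^ 'n.
        (\<forall>i. holomorphic_fun_on A (\<lambda>x. g x $ i) U) \<and>
        (\<forall>(V, \<phi>)\<in>A. p \<in> V \<longrightarrow>
           (\<exists>D. ((\<lambda>z. g (inv_into V \<phi> z)) has_derivative D) (at (\<phi> p)) \<and> bij D)))"

text \<open>
  A domain that is a Stein manifold, in the sense of Hormander's definition; the remaining condition
  there, countability at infinity, is automatic here.
\<close>

definition stein_domain :: "('a::metric_space, 'n::finite) chart set \<Rightarrow> 'a set \<Rightarrow> bool" where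
  "stein_domain A U \<longleftrightarrow>
     open U \<and> connected U \<and> U \<noteq> {} \<and>
     holomorphically_convex A U \<and>
     holomorphically_separable A U \<and>
     global_local_coordinates A U"

text \<open>
  A regular Borel measure on the subspace \<open>X\<close>: finite on compact sets, outer regular with respect to
  relatively open sets and inner regular with respect to compact sets.
\<close>

definition regular_borel_measure_on :: "'a::metric_space set \<Rightarrow> 'a measure \<Rightarrow> bool" where
  "regular_borel_measure_on X \<mu> \<longleftrightarrow>
     space \<mu> = X \<and>
     sets \<mu> = sets (restrict_space borel X) \<and>
     (\<forall>K\<subseteq>X. compact K \<longrightarrow> emeasure \<mu> K < \<infinity>) \<and>
     (\<forall>B\<in>sets \<mu>.
        emeasure \<mu> B = (INF G\<in>{G. openin (top_of_set X) G \<and> B \<subseteq> G}. emeasure \<mu> G) \<and>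
        emeasure \<mu> B = (SUP K\<in>{K. compact K \<and> K \<subseteq> B}. emeasure \<mu> K))"

end

theory Submission
  imports Defs "HOL-Complex_Analysis.Cauchy_Integral_Formula"
begin

text \<open>
  The function \<open>f\<close> is the sum of a series of holomorphic functions built along an exhaustion
  \<open>K 0 \<subseteq> K 1 \<subseteq> \<dots>\<close> of \<open>U\<close> by compact holomorphically convex sets.  The \<open>j\<close>th term is tiny on \<open>K j\<close>, and makes the
  partial sum close to a prescribed continuous function \<open>\<Psi> j\<close> on a compact subset \<open>E j\<close> of the shell
  \<open>K (j + 1) - K j\<close> whose complement in the shell has as small a measure as desired.

  The existence of such terms needs neither the Oka--Weil theorem nor local coordinates, only
  that the holomorphic functions on \<open>U\<close> form an algebra which separates points, together with holomorphic
  convexity (\<open>approximate_extending_zero\<close>).  On a compact set on which \<open>Re g\<close> stays away from \<open>c\<close>, the indicator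
  function of \<open>{Re g > c}\<close> is a uniform limit of members of the algebra: with \<open>h = g - c\<close>, first
  \<open>1 / h\<close> is such a limit, by pole pushing along the imaginary axis, hence so is every iterate of
  \<open>h\<close> under \<open>z \<mapsto> (z + 1 / z) / 2\<close>, and these iterates converge uniformly to the sign of \<open>Re h\<close>
  (\<open>approximable_sgn\<close>).  Finitely many cuts \<open>Re g = c\<close> along level sets of measure zero therefore allow any
  continuous function to be approximated outside thin strips around the cuts.

  For the boundary behaviour, Lusin's theorem gives increasing closed sets \<open>B j \<supseteq> S\<close> in the
  boundary on which \<open>\<psi>\<close> is continuous and whose union \<open>F\<close> has full measure; \<open>\<Psi> j\<close> is a Tietze extension of
  \<open>\<psi>\<close> from \<open>B j\<close>.  Near \<open>p \<in> B j\<close> the function \<open>\<Psi> j\<close> is close to \<open>\<psi> p\<close> only at points closer to \<open>p\<close> than some \<open>\<eta> j\<close>,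
  which tells nothing about the rest of shell \<open>j\<close>.  But \<open>\<eta> j\<close> can be fixed before \<open>K j\<close>, and \<open>K j\<close> then taken so
  large that, within a compact set \<open>C (j + 1)\<close> of an exhaustion of the manifold, \<open>U - K j\<close> is negligible against
  \<open>ball p r \<inter> U\<close> for all \<open>p \<in> C j\<close> and \<open>r \<ge> \<eta> j\<close>: by compactness the measures of these sets have a positive
  lower bound, apart from points \<open>p\<close> with a neighbourhood whose intersection with \<open>U\<close> is null, for which the empty
  approach set will do.  The same lower bound, for balls whose radius is
  the distance of shell \<open>j\<close> to the boundary, tells how small the complement of \<open>E j\<close> has to be
  (\<open>exists_function_with_boundary_values\<close>).
\<close>

section \<open>Uniform approximation by members of a function algebra\<close>

text \<open>
  An algebra \<open>\<O>\<close> of functions with complex values that contains the constants and whose members are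
  continuous on \<open>U\<close>.  The members are total functions, of which only the values on \<open>U\<close> matter; in the
  application \<open>\<O>\<close> is the algebra of holomorphic functions on \<open>U\<close>.
\<close>

locale function_algebra =
  fixes \<O> :: "('a::metric_space \<Rightarrow> complex) set" and U :: "'a set"
  assumes const_mem: "(\<lambda>_. c) \<in> \<O>"
    and add_mem: "\<lbrakk>f \<in> \<O>; g \<in> \<O>\<rbrakk> \<Longrightarrow> (\<lambda>x. f x + g x) \<in> \<O>"
    and mult_mem: "\<lbrakk>f \<in> \<O>; g \<in> \<O>\<rbrakk> \<Longrightarrow> (\<lambda>x. f x * g x) \<in> \<O>"
    and continuous_on_mem: "f \<in> \<O> \<Longrightarrow> continuous_on U f"
begin

text \<open>\<open>h\<close> is a uniform limit on \<open>X\<close> of members of the algebra.\<close>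

definition approximable :: "'a set \<Rightarrow> ('a \<Rightarrow> complex) \<Rightarrow> bool" where
  "approximable X h \<longleftrightarrow> (\<forall>e>0. \<exists>f\<in>\<O>. \<forall>x\<in>X. cmod (f x - h x) < e)"

lemma approximableE:
  assumes "approximable X h" "e > 0"
  obtains f where "f \<in> \<O>" "\<forall>x\<in>X. cmod (f x - h x) < e"
  using assms unfolding approximable_def by blast

lemma power_mem: "f \<in> \<O> \<Longrightarrow> (\<lambda>x. f x ^ n) \<in> \<O>"
  by (induction n) (auto intro: const_mem mult_mem)

lemma approximable_mem: "f \<in> \<O> \<Longrightarrow> approximable X f"
  unfolding approximable_def by (intro allI impI bexI[of _ f]) auto

lemma approximable_const: "approximable X (\<lambda>_. c)"
  by (intro approximable_mem const_mem)

lemma approximable_cong: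
  assumes "approximable X h" "\<And>x. x \<in> X \<Longrightarrow> h x = k x"
  shows "approximable X k"
  using assms unfolding approximable_def by simp

lemma approximable_limit:
  assumes "\<And>e. e > 0 \<Longrightarrow> \<exists>k. approximable X k \<and> (\<forall>x\<in>X. cmod (k x - h x) < e)"
  shows "approximable X h"
  unfolding approximable_def
proof (intro allI impI)
  fix e :: real assume "e > 0"
  then obtain k where k: "approximable X k" "\<forall>x\<in>X. cmod (k x - h x) < e / 2"
    using assms half_gt_zero by blast
  then obtain f where f: "f \<in> \<O>" "\<forall>x\<in>X. cmod (f x - k x) < e / 2"
    using approximableE \<open>e > 0\<close> half_gt_zero by blast
  have "cmod (f x - h x) < e" if "x \<in> X" for x
    using norm_diff_triangle_less k(2) f(2) that by (metis field_sum_of_halves)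
  with f(1) show "\<exists>f\<in>\<O>. \<forall>x\<in>X. cmod (f x - h x) < e" by blast
qed

lemma bounded_mem:
  assumes "f \<in> \<O>" "compact X" "X \<subseteq> U"
  shows "\<exists>B>0. \<forall>x\<in>X. cmod (f x) \<le> B"
proof -
  have "bounded (f ` X)"
    by (meson assms compact_continuous_image compact_imp_bounded continuous_on_mem continuous_on_subset)
  then show ?thesis by (auto simp: bounded_pos)
qed

lemma approximable_bounded:
  assumes "approximable X h" "compact X" "X \<subseteq> U"
  shows "\<exists>B>0. \<forall>x\<in>X. cmod (h x) \<le> B"
proof -
  obtain f where f: "f \<in> \<O>" "\<forall>x\<in>X. cmod (f x - h x) < 1"
    using assms(1) unfolding approximable_def by (meson zero_less_one)
  obtain B where B: "B > 0" "\<forall>x\<in>X. cmod (f x) \<le> B"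
    using bounded_mem[OF f(1) assms(2,3)] by blast
  have "cmod (h x) \<le> B + 1" if "x \<in> X" for x
    using norm_triangle_sub[of "h x" "f x"] f(2) B(2) that by (smt (verit) norm_minus_commute)
  then show ?thesis using \<open>B > 0\<close> by (intro exI[of _ "B + 1"]) auto
qed

lemma approximable_add:
  assumes "approximable X h" "approximable X k"
  shows "approximable X (\<lambda>x. h x + k x)"
  unfolding approximable_def
proof (intro allI impI)
  fix e :: real assume "e > 0"
  then have "e / 2 > 0" by simp
  obtain f where "f \<in> \<O>" and f: "\<forall>x\<in>X. cmod (f x - h x) < e / 2"
    using approximableE[OF assms(1) \<open>e / 2 > 0\<close>] .
  obtain g where "g \<in> \<O>" and g: "\<forall>x\<in>X. cmod (g x - k x) < e / 2"
    using approximableE[OF assms(2) \<open>e / 2 > 0\<close>] .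
  note fg = f g
  have "cmod ((f x + g x) - (h x + k x)) < e" if "x \<in> X" for x
    using norm_diff_triangle_ineq[of "f x" "g x" "h x" "k x"] fg(1)[rule_format, OF that]
      fg(2)[rule_format, OF that] by linarith
  then show "\<exists>f\<in>\<O>. \<forall>x\<in>X. cmod (f x - (h x + k x)) < e"
    using add_mem[OF \<open>f \<in> \<O>\<close> \<open>g \<in> \<O>\<close>] by (intro bexI[of _ "\<lambda>x. f x + g x"]) auto
qed

lemma approximable_mult:
  assumes "approximable X h" "approximable X k" "compact X" "X \<subseteq> U"
  shows "approximable X (\<lambda>x. h x * k x)"
  unfolding approximable_def
proof (intro allI impI)
  fix e :: real assume "e > 0"
  obtain B where B: "B > 0" "\<forall>x\<in>X. cmod (k x) \<le> B"
    using approximable_bounded assms by blast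
  obtain f where f: "f \<in> \<O>" "\<forall>x\<in>X. cmod (f x - h x) < e / (2 * B)"
    using approximableE[OF assms(1), of "e / (2 * B)"] B(1) \<open>e > 0\<close> by (auto intro: that)
  obtain C where C: "C > 0" "\<forall>x\<in>X. cmod (f x) \<le> C"
    using bounded_mem f assms by blast
  obtain g where g: "g \<in> \<O>" "\<forall>x\<in>X. cmod (g x - k x) < e / (2 * C)"
    using approximableE[OF assms(2), of "e / (2 * C)"] C(1) \<open>e > 0\<close> by (auto intro: that)
  have "cmod (f x * g x - h x * k x) < e" if "x \<in> X" for x
  proof -
    have "f x * g x - h x * k x = f x * (g x - k x) + (f x - h x) * k x"
      by (simp add: algebra_simps)
    then have "cmod (f x * g x - h x * k x) \<le> cmod (f x) * cmod (g x - k x) + cmod (f x - h x) * cmod (k x)"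
      by (metis norm_mult norm_triangle_ineq)
    also have "\<dots> \<le> C * cmod (g x - k x) + cmod (f x - h x) * B"
      using B C that by (intro add_mono mult_mono) auto
    also have "\<dots> < C * (e / (2 * C)) + e / (2 * B) * B"
      using B(1) C(1) f(2) g(2) that by (intro add_strict_mono mult_strict_left_mono mult_strict_right_mono) auto
    also have "\<dots> = e" using B(1) C(1) by simp
    finally show ?thesis .
  qed
  then show "\<exists>f\<in>\<O>. \<forall>x\<in>X. cmod (f x - h x * k x) < e"
    using mult_mem[OF f(1) g(1)] by (intro bexI[of _ "\<lambda>x. f x * g x"]) auto
qed

lemma approximable_sum:
  assumes "finite I" "\<And>i. i \<in> I \<Longrightarrow> approximable X (h i)"
  shows "approximable X (\<lambda>x. \<Sum>i\<in>I. h i x)"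
  using assms by (induction I rule: finite_induct) (auto intro: approximable_const approximable_add)

end

text \<open>On a compact subset of \<open>U\<close> the approximable functions are bounded and form an algebra.\<close>

locale compact_in_function_algebra = function_algebra +
  fixes X :: "'a set"
  assumes compact: "compact X" and subset: "X \<subseteq> U"
begin

lemmas bounded = approximable_bounded[OF _ compact subset]
lemmas mult = approximable_mult[OF _ _ compact subset]

lemma approximable_cmult: "approximable X h \<Longrightarrow> approximable X (\<lambda>x. c * h x)"
  by (intro mult approximable_const)

lemma approximable_diff:
  assumes "approximable X h" "approximable X k"
  shows "approximable X (\<lambda>x. h x - k x)"
  using approximable_add[OF assms(1) approximable_cmult[OF assms(2), of "-1"]] by simp

lemma approximable_power: "approximable X h \<Longrightarrow> approximable X (\<lambda>x. h x ^ n)"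
  by (induction n) (auto intro: approximable_const mult)

lemma approximable_geometric:
  assumes "approximable X r" "\<And>x. x \<in> X \<Longrightarrow> cmod (r x) \<le> 1 / 2"
  shows "approximable X (\<lambda>x. 1 / (1 - r x))"
proof (rule approximable_limit)
  fix e :: real assume "e > 0"
  obtain n where n: "(1 / 2) ^ n < e / 2"
    using real_arch_pow_inv[of "e / 2" "1 / 2"] \<open>e > 0\<close> by auto
  have "cmod ((\<Sum>k<n. r x ^ k) - 1 / (1 - r x)) < e" if "x \<in> X" for x
  proof -
    have r: "cmod (r x) \<le> 1 / 2" using assms(2) that .
    have ne: "r x \<noteq> 1" using r by auto
    have "(\<Sum>k<n. r x ^ k) - 1 / (1 - r x) = - (r x ^ n) / (1 - r x)"
      using ne by (simp add: sum_gp_strict diff_divide_distrib)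
    moreover have "cmod (1 - r x) \<ge> 1 / 2"
      using norm_triangle_ineq2[of 1 "r x"] r by simp
    moreover have "cmod (r x ^ n) \<le> (1 / 2) ^ n"
      using r by (simp add: norm_power power_mono)
    ultimately have "cmod ((\<Sum>k<n. r x ^ k) - 1 / (1 - r x)) \<le> (1 / 2) ^ n / (1 / 2)"
      by (simp only: norm_divide norm_minus_cancel) (intro frac_le, auto)
    then show ?thesis using n by simp
  qed
  moreover have "approximable X (\<lambda>x. \<Sum>k<n. r x ^ k)"
    by (intro approximable_sum approximable_power assms) auto
  ultimately show "\<exists>k. approximable X k \<and> (\<forall>x\<in>X. cmod (k x - 1 / (1 - r x)) < e)" by blast
qed

text \<open>
  Pole pushing: \<open>1 / (h - \<i>t)\<close> is a geometric series in \<open>h\<close> for large real \<open>t\<close>, and the pole \<open>\<i>t\<close> is then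
  moved down the imaginary axis to \<open>0\<close> in steps of length at most \<open>\<delta> / 2\<close>, as \<open>\<bar>h - \<i>t\<bar> \<ge> \<delta>\<close> for all real \<open>t\<close>.
\<close>

lemma approximable_inverse:
  assumes h: "approximable X h" and "\<delta> > 0" and \<delta>: "\<And>x. x \<in> X \<Longrightarrow> \<bar>Re (h x)\<bar> \<ge> \<delta>"
  shows "approximable X (\<lambda>x. 1 / h x)"
proof -
  obtain B where B: "B > 0" "\<And>x. x \<in> X \<Longrightarrow> cmod (h x) \<le> B"
    using bounded[OF h] by blast
  obtain N :: nat where N: "2 * B / (\<delta> / 2) < real N"
    using reals_Archimedean2 by blast
  then have "N > 0" using B(1) \<open>\<delta> > 0\<close> by (cases N) (auto simp: divide_less_0_iff not_less[symmetric])
  define s where "s = 2 * B / real N"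
  have s: "0 < s" "s \<le> \<delta> / 2"
    using N \<open>N > 0\<close> B(1) \<open>\<delta> > 0\<close> by (auto simp: s_def field_simps)
  \<comment> \<open>The successive poles, from \<open>2B\<i>\<close> down to \<open>0\<close>.\<close>
  define q where "q n = \<i> * of_real (2 * B - real n * s)" for n
  have dist_ge: "\<delta> \<le> cmod (h x - \<i> * of_real t)" if "x \<in> X" for x t
    using abs_Re_le_cmod[of "h x - \<i> * of_real t"] \<delta>[OF that] by simp
  have "approximable X (\<lambda>x. 1 / (h x - q n))" for n
  proof (induction n)
    case 0
    have q0: "q 0 \<noteq> 0" "cmod (q 0) = 2 * B" using B(1) by (auto simp: q_def norm_mult)
    have "approximable X (\<lambda>x. 1 / (1 - 1 / q 0 * h x))"
    proof (rule approximable_geometric)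
      show "approximable X (\<lambda>x. 1 / q 0 * h x)" by (intro approximable_cmult h)
      show "cmod (1 / q 0 * h x) \<le> 1 / 2" if "x \<in> X" for x
        using B(1) B(2)[OF that] q0 by (simp add: norm_mult norm_divide field_simps)
    qed
    then have "approximable X (\<lambda>x. - 1 / q 0 * (1 / (1 - 1 / q 0 * h x)))"
      by (rule approximable_cmult)
    then show ?case
    proof (rule approximable_cong)
      fix x assume "x \<in> X"
      have "h x \<noteq> q 0" using B(2)[OF \<open>x \<in> X\<close>] B(1) q0(2) by auto
      then show "- 1 / q 0 * (1 / (1 - 1 / q 0 * h x)) = 1 / (h x - q 0)"
        using q0(1) by (simp add: field_simps)
    qed
  next
    case (Suc n)
    define d where "d = q (Suc n) - q n"
    have d: "cmod d \<le> \<delta> / 2"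
    proof -
      have "d = - (\<i> * of_real s)" by (simp add: d_def q_def algebra_simps)
      then show ?thesis using s by (simp add: norm_mult)
    qed
    have qn: "\<delta> \<le> cmod (h x - q n)" "\<delta> \<le> cmod (h x - q (Suc n))" if "x \<in> X" for x
      unfolding q_def by (rule dist_ge[OF that])+
    have "approximable X (\<lambda>x. 1 / (1 - d * (1 / (h x - q n))))"
    proof (rule approximable_geometric)
      show "approximable X (\<lambda>x. d * (1 / (h x - q n)))" by (intro approximable_cmult Suc)
      show "cmod (d * (1 / (h x - q n))) \<le> 1 / 2" if "x \<in> X" for x
      proof -
        have "cmod d / cmod (h x - q n) \<le> (\<delta> / 2) / \<delta>"
          using d qn(1)[OF that] \<open>\<delta> > 0\<close> by (intro frac_le) auto
        then show ?thesis using \<open>\<delta> > 0\<close> by (simp add: norm_mult norm_divide)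
      qed
    qed
    from mult[OF Suc this] show ?case
    proof (rule approximable_cong)
      fix x assume "x \<in> X"
      have "h x - q n \<noteq> 0" "h x - q (Suc n) \<noteq> 0"
        using qn[OF \<open>x \<in> X\<close>] \<open>\<delta> > 0\<close> by auto
      moreover have "1 - d * (1 / (h x - q n)) = (h x - q (Suc n)) / (h x - q n)"
        using calculation by (simp add: d_def field_simps)
      ultimately show "1 / (h x - q n) * (1 / (1 - d * (1 / (h x - q n)))) = 1 / (h x - q (Suc n))"
        by simp
    qed
  qed
  from this[of N] show ?thesis using \<open>N > 0\<close> by (simp add: q_def s_def)
qed

end

section \<open>Indicator functions of half-planes\<close>

text \<open>
  Newton's iteration for \<open>z\<^sup>2 = 1\<close>.  In the coordinate \<open>w = (z - 1) / (z + 1)\<close> it is the squaring map, so it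
  converges to \<open>1\<close> on the right half-plane and to \<open>-1\<close> on the left one, locally uniformly.
\<close>

fun sign_iterate :: "nat \<Rightarrow> complex \<Rightarrow> complex" where
  "sign_iterate 0 z = z"
| "sign_iterate (Suc k) z = (sign_iterate k z + 1 / sign_iterate k z) / 2"

lemma sign_iterate_uminus: "sign_iterate k (- z) = - sign_iterate k z"
  by (induction k) (auto simp: field_simps)

lemma sign_iterate_eq:
  assumes "Re z > 0"
  defines "w \<equiv> (z - 1) / (z + 1)"
  shows "cmod w < 1" "sign_iterate k z = (1 + w ^ (2 ^ k)) / (1 - w ^ (2 ^ k))"
proof -
  have z1: "z + 1 \<noteq> 0" using assms by (auto simp: complex_eq_iff)
  have "cmod (z - 1) < cmod (z + 1)"
  proof -
    have "(cmod (z - 1))\<^sup>2 < (cmod (z + 1))\<^sup>2"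
      using assms unfolding cmod_power2 by (simp add: power2_eq_square algebra_simps)
    then show ?thesis using power2_less_imp_less norm_ge_zero by blast
  qed
  then show w1: "cmod w < 1" using z1 by (simp add: w_def norm_divide)
  show "sign_iterate k z = (1 + w ^ (2 ^ k)) / (1 - w ^ (2 ^ k))"
  proof (induction k)
    case 0
    have "1 - w \<noteq> 0" using w1 by auto
    moreover have "z * (1 - w) = 1 + w" using z1 by (simp add: w_def field_simps)
    ultimately show ?case by (simp add: field_simps)
  next
    case (Suc k)
    define v where "v = w ^ (2 ^ k)"
    have v1: "cmod v < 1" using w1 by (simp add: v_def norm_power power_less_one_iff)
    have ne: "1 - v \<noteq> 0" "1 + v \<noteq> 0" "1 - v\<^sup>2 \<noteq> 0"
      using v1 by (auto simp: power2_eq_1_iff add_eq_0_iff)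
    have "w ^ 2 ^ Suc k = v\<^sup>2" by (simp add: v_def power_mult[symmetric] mult.commute)
    moreover have "((1 + v) / (1 - v) + 1 / ((1 + v) / (1 - v))) / 2 = (1 + v\<^sup>2) / (1 - v\<^sup>2)"
    proof -
      have "1 - v\<^sup>2 = (1 - v) * (1 + v)" by (simp add: power2_eq_square algebra_simps)
      then show ?thesis using ne by (simp add: divide_simps) (simp add: power2_eq_square algebra_simps)
    qed
    ultimately show ?case unfolding sign_iterate.simps Suc v_def[symmetric] by (simp only:)
  qed
qed

lemma Re_one_div: "Re (1 / z) = Re z / (cmod z)\<^sup>2"
  by (simp add: Re_divide cmod_power2)

lemma sign_iterate_bound:
  assumes "Re z \<ge> \<delta>" "\<delta> > 0" "cmod z \<le> B"
  defines "\<rho> \<equiv> sqrt (1 - 4 * \<delta> / (B + 1)\<^sup>2)"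
  shows "\<rho> < 1" "\<rho> \<ge> 0" "cmod (sign_iterate k z - 1) \<le> 2 / (1 - \<rho>) * \<rho> ^ (2 ^ k)"
proof -
  define w where "w = (z - 1) / (z + 1)"
  have Re: "Re z > 0" using assms by linarith
  have B: "B \<ge> \<delta>" using assms complex_Re_le_cmod[of z] by linarith
  have z1: "cmod (z + 1) > 0" using Re by (auto simp: complex_eq_iff)
  have z1B: "cmod (z + 1) \<le> B + 1" using norm_triangle_ineq[of z 1] assms by simp
  have w1: "cmod w < 1" and it: "sign_iterate k z = (1 + w ^ (2 ^ k)) / (1 - w ^ (2 ^ k))"
    using sign_iterate_eq[OF Re] by (auto simp: w_def)
  have "(cmod w)\<^sup>2 = 1 - 4 * Re z / (cmod (z + 1))\<^sup>2"
  proof -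
    have "(cmod (z - 1))\<^sup>2 = (cmod (z + 1))\<^sup>2 - 4 * Re z"
      unfolding cmod_power2 by (simp add: power2_eq_square algebra_simps)
    then have "(cmod w)\<^sup>2 = ((cmod (z + 1))\<^sup>2 - 4 * Re z) / (cmod (z + 1))\<^sup>2"
      by (simp only: w_def norm_divide power_divide)
    then show ?thesis using z1 by (simp add: diff_divide_distrib)
  qed
  also have "\<dots> \<le> 1 - 4 * \<delta> / (B + 1)\<^sup>2"
  proof -
    have "4 * \<delta> / (B + 1)\<^sup>2 \<le> 4 * Re z / (cmod (z + 1))\<^sup>2"
      using assms z1 z1B Re by (intro frac_le power_mono) auto
    then show ?thesis by simp
  qed
  finally have w2: "(cmod w)\<^sup>2 \<le> 1 - 4 * \<delta> / (B + 1)\<^sup>2" .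
  then have w\<rho>: "cmod w \<le> \<rho>" unfolding \<rho>_def by (rule real_le_rsqrt)
  show "\<rho> < 1" using B \<open>\<delta> > 0\<close> by (auto simp: \<rho>_def)
  show "\<rho> \<ge> 0" using w\<rho> norm_ge_zero order_trans by blast
  define v where "v = w ^ (2 ^ k)"
  have v\<rho>: "cmod v \<le> \<rho> ^ (2 ^ k)" using w\<rho> by (simp add: v_def norm_power power_mono)
  have "\<rho> ^ (2 ^ k) \<le> \<rho>" using \<open>\<rho> < 1\<close> \<open>\<rho> \<ge> 0\<close> by (intro power_le_one_iff[THEN iffD2] self_le_power power_decreasing[of 1 "2^k" \<rho>, simplified]) auto
  then have "cmod v \<le> \<rho>" using v\<rho> by linarith
  then have ge: "cmod (1 - v) \<ge> 1 - \<rho>" using norm_triangle_ineq2[of 1 v] by simp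
  have "1 - v \<noteq> 0" using ge \<open>\<rho> < 1\<close> by auto
  then have "sign_iterate k z - 1 = 2 * v / (1 - v)" using it by (simp add: v_def[symmetric] field_simps)
  then have "cmod (sign_iterate k z - 1) = 2 * cmod v / cmod (1 - v)" by (simp add: norm_divide norm_mult)
  also have "\<dots> \<le> 2 * \<rho> ^ (2 ^ k) / (1 - \<rho>)"
    using ge v\<rho> \<open>\<rho> < 1\<close> \<open>\<rho> \<ge> 0\<close> by (intro frac_le) auto
  finally show "cmod (sign_iterate k z - 1) \<le> 2 / (1 - \<rho>) * \<rho> ^ (2 ^ k)" by simp
qed

context compact_in_function_algebra
begin

lemma approximable_sign_iterate:
  assumes "approximable X h" "\<delta> > 0" "\<And>x. x \<in> X \<Longrightarrow> \<bar>Re (h x)\<bar> \<ge> \<delta>"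
  shows "approximable X (\<lambda>x. sign_iterate k (h x))
    \<and> (\<exists>\<delta>'>0. \<forall>x\<in>X. \<bar>Re (sign_iterate k (h x))\<bar> \<ge> \<delta>')"
proof (induction k)
  case 0
  then show ?case using assms by auto
next
  case (Suc k)
  then obtain \<delta>' where \<delta>': "\<delta>' > 0" "\<And>x. x \<in> X \<Longrightarrow> \<bar>Re (sign_iterate k (h x))\<bar> \<ge> \<delta>'"
    and ap: "approximable X (\<lambda>x. sign_iterate k (h x))" by blast
  have "approximable X (\<lambda>x. 1 / 2 * (sign_iterate k (h x) + 1 / sign_iterate k (h x)))"
    using approximable_inverse[OF ap \<delta>'] ap by (intro approximable_cmult approximable_add)
  moreover have "\<delta>' / 2 \<le> \<bar>Re (sign_iterate (Suc k) (h x))\<bar>" if "x \<in> X" for x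
  proof -
    define z where "z = sign_iterate k (h x)"
    have "Re (sign_iterate (Suc k) (h x)) = (Re z + Re (1 / z)) / 2"
      by (simp add: z_def)
    also have "\<dots> = Re z * ((1 + 1 / (cmod z)\<^sup>2) / 2)"
      unfolding Re_one_div by (simp add: distrib_left add_divide_distrib)
    finally have "Re (sign_iterate (Suc k) (h x)) = Re z * ((1 + 1 / (cmod z)\<^sup>2) / 2)" .
    moreover have "\<bar>Re z\<bar> * (1 / 2) \<le> \<bar>Re z\<bar> * \<bar>(1 + 1 / (cmod z)\<^sup>2) / 2\<bar>"
      by (intro mult_left_mono) auto
    ultimately have "\<bar>Re z\<bar> * (1 / 2) \<le> \<bar>Re (sign_iterate (Suc k) (h x))\<bar>"
      by (simp only: abs_mult)
    then show ?thesis using \<delta>'(2)[OF that] unfolding z_def by linarith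
  qed
  ultimately show ?case using \<delta>'(1) by (intro conjI exI[of _ "\<delta>' / 2"]) auto
qed

lemma approximable_sgn:
  assumes "approximable X h" "\<delta> > 0" "\<And>x. x \<in> X \<Longrightarrow> \<bar>Re (h x)\<bar> \<ge> \<delta>"
  shows "approximable X (\<lambda>x. of_real (sgn (Re (h x))))"
proof (cases "X = {}")
  case True
  then show ?thesis using const_mem by (auto simp: approximable_def)
next
  case False
  then obtain x0 where "x0 \<in> X" by blast
  obtain B where B: "B > 0" "\<And>x. x \<in> X \<Longrightarrow> cmod (h x) \<le> B"
    using bounded[OF assms(1)] by blast
  define \<rho> where "\<rho> = sqrt (1 - 4 * \<delta> / (B + 1)\<^sup>2)"
  \<comment> \<open>The iteration is odd, so the left half-plane reduces to the right one.\<close>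
  have key: "\<rho> < 1 \<and> \<rho> \<ge> 0 \<and>
      cmod (sign_iterate k (h x) - of_real (sgn (Re (h x)))) \<le> 2 / (1 - \<rho>) * \<rho> ^ (2 ^ k)"
    if "x \<in> X" for x k
  proof (cases "Re (h x) > 0")
    case True
    then have "Re (h x) \<ge> \<delta>" using assms(3)[OF that] by auto
    from sign_iterate_bound[OF this \<open>\<delta> > 0\<close> B(2)[OF that]] show ?thesis
      using True by (simp add: \<rho>_def)
  next
    case False
    then have neg: "Re (h x) < 0" and "Re (- h x) \<ge> \<delta>" using assms(2) assms(3)[OF that] by auto
    have "cmod (sign_iterate k (h x) - of_real (sgn (Re (h x)))) = cmod (- (sign_iterate k (- h x) - 1))"
      using neg by (simp add: sign_iterate_uminus add.commute)
    then have "cmod (sign_iterate k (h x) - of_real (sgn (Re (h x)))) = cmod (sign_iterate k (- h x) - 1)"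
      by (simp only: norm_minus_cancel)
    moreover have "cmod (- h x) \<le> B" using B(2)[OF that] by simp
    ultimately show ?thesis
      using sign_iterate_bound[OF \<open>Re (- h x) \<ge> \<delta>\<close> \<open>\<delta> > 0\<close>]
      unfolding \<rho>_def by metis
  qed
  show ?thesis
  proof (rule approximable_limit)
    fix e :: real assume "e > 0"
    have \<rho>: "\<rho> < 1" "\<rho> \<ge> 0" using key[OF \<open>x0 \<in> X\<close>] by auto
    obtain k where k: "\<rho> ^ k < e * (1 - \<rho>) / 2"
      using real_arch_pow_inv[of "e * (1 - \<rho>) / 2" \<rho>] \<rho> \<open>e > 0\<close> by auto
    have "\<rho> ^ (2 ^ k) \<le> \<rho> ^ k"
      using \<rho> by (intro power_decreasing) (auto intro: less_imp_le less_exp)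
    then have "2 / (1 - \<rho>) * \<rho> ^ (2 ^ k) < e" using k \<rho> by (simp add: field_simps)
    then have "\<forall>x\<in>X. cmod (sign_iterate k (h x) - of_real (sgn (Re (h x)))) < e"
      using key by (meson le_less_trans)
    then show "\<exists>k. approximable X k \<and> (\<forall>x\<in>X. cmod (k x - of_real (sgn (Re (h x)))) < e)"
      using approximable_sign_iterate[OF assms, of k] by blast
  qed
qed

lemma approximable_half_plane:
  assumes "g \<in> \<O>" "\<delta> > 0" "\<And>x. x \<in> X \<Longrightarrow> \<bar>Re (g x) - c\<bar> \<ge> \<delta>"
  shows "approximable X (\<lambda>x. of_bool (Re (g x) > c))"
proof -
  have "approximable X (\<lambda>x. of_real (sgn (Re (g x - of_real c))))"
    using assms by (intro approximable_sgn[where \<delta> = \<delta>] approximable_diff approximable_mem approximable_const) auto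
  then have "approximable X (\<lambda>x. 1 / 2 * (of_real (sgn (Re (g x - of_real c))) + 1))"
    by (intro approximable_cmult approximable_add approximable_const)
  then show ?thesis
  proof (rule approximable_cong)
    fix x assume "x \<in> X"
    then have "Re (g x) \<noteq> c" using assms(2) assms(3)[of x] by auto
    then show "1 / 2 * (of_real (sgn (Re (g x - of_real c))) + 1) = (of_bool (c < Re (g x)) :: complex)"
      by (auto simp: sgn_if)
  qed
qed

text \<open>
  Every function that depends only on which of finitely many conditions \<open>P i\<close> hold is approximable,
  if the indicator functions of these conditions are.
\<close>

lemma approximable_pattern:
  assumes "finite I" "\<And>i. i \<in> I \<Longrightarrow> approximable X (\<lambda>x. of_bool (P i x))"
  shows "approximable X (\<lambda>x. F {i \<in> I. P i x})"
  using assms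
proof (induction I arbitrary: F rule: finite_induct)
  case empty
  then show ?case by (simp add: approximable_const)
next
  case (insert j I)
  have j: "approximable X (\<lambda>x. of_bool (P j x))" using insert by blast
  have "approximable X (\<lambda>x. of_bool (P j x) * F (insert j {i \<in> I. P i x}) + (1 - of_bool (P j x)) * F {i \<in> I. P i x})"
    using insert.IH[of "\<lambda>A. F (insert j A)"] insert.IH[of F] insert.prems j
    by (intro approximable_add mult approximable_diff approximable_const) auto
  then show ?case
  proof (rule approximable_cong)
    fix x
    have "{i \<in> insert j I. P i x} = (if P j x then insert j {i \<in> I. P i x} else {i \<in> I. P i x})" by auto
    then show "of_bool (P j x) * F (insert j {i \<in> I. P i x}) + (1 - of_bool (P j x)) * F {i \<in> I. P i x}
       = F {i \<in> insert j I. P i x}" by simp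
  qed
qed

end

section \<open>Regular Borel measures and thin strips around level sets\<close>

lemma regular_borel_sets:
  assumes "regular_borel_measure_on X \<mu>" "B \<in> sets borel" "B \<subseteq> X"
  shows "B \<in> sets \<mu>"
  using assms by (auto simp: regular_borel_measure_on_def sets_restrict_space image_iff)

lemma regular_borel_sets_UNIV:
  assumes "regular_borel_measure_on UNIV \<mu>"
  shows "sets \<mu> = sets borel"
  using assms by (auto simp: regular_borel_measure_on_def sets_restrict_space)

lemma regular_borel_inner_compact:
  fixes e :: real
  assumes "regular_borel_measure_on X \<mu>" "B \<in> sets \<mu>" "emeasure \<mu> B < \<infinity>" "e > 0"
  obtains K where "compact K" "K \<subseteq> B" "emeasure \<mu> (B - K) < ennreal e"
proof -
  have eq: "emeasure \<mu> B = (SUP K\<in>{K. compact K \<and> K \<subseteq> B}. emeasure \<mu> K)"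
    and sp: "space \<mu> = X"
    using assms(1,2) unfolding regular_borel_measure_on_def by (blast, blast)
  have ne: "{K. compact K \<and> K \<subseteq> B} \<noteq> {}" using compact_empty by blast
  have "emeasure \<mu> B \<noteq> \<infinity>" using assms(3) by simp
  from SUP_approx_ennreal[OF \<open>e > 0\<close> ne eq this]
  obtain K where K: "compact K" "K \<subseteq> B" "emeasure \<mu> B < emeasure \<mu> K + e" by auto
  have "B \<subseteq> X" using assms(2) sets.sets_into_space sp by blast
  then have Ks: "K \<in> sets \<mu>"
    using K by (intro regular_borel_sets[OF assms(1)]) (auto intro: borel_compact)
  have fin: "emeasure \<mu> K < \<infinity>"
    using emeasure_mono[OF K(2) assms(2)] assms(3) by (rule le_less_trans)
  have "emeasure \<mu> (B - K) = emeasure \<mu> B - emeasure \<mu> K"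
    using fin by (intro emeasure_Diff assms Ks K) auto
  also have "\<dots> < ennreal e"
    using K(3) fin emeasure_mono[OF K(2) assms(2)] by (subst minus_less_iff_ennreal) (auto simp: add.commute)
  finally show thesis using that K by blast
qed

text \<open>The levels of positive measure are the atoms of the finite image measure under \<open>g\<close>.\<close>

lemma countable_charged_levels:
  fixes g :: "'a::metric_space \<Rightarrow> real"
  assumes "sets \<mu> = sets borel" "L \<in> sets borel" "emeasure \<mu> L < \<infinity>" "continuous_on L g"
  shows "countable {c. emeasure \<mu> {x\<in>L. g x = c} \<noteq> 0}"
proof -
  have Ls: "L \<in> sets \<mu>" using assms by simp
  have spU: "space \<mu> = UNIV" using sets_eq_imp_space_eq[OF assms(1)] by simp
  define R where "R = restrict_space \<mu> L"
  have sR: "sets R = sets (restrict_space borel L)"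
    unfolding R_def using assms(1) by (rule sets_restrict_space_cong)
  have gm: "g \<in> borel_measurable R"
    using borel_measurable_continuous_on_restrict[OF assms(4)] measurable_cong_sets[OF sR refl] by blast
  have spR: "space R = L" unfolding R_def by (simp add: space_restrict_space spU)
  define N where "N = distr R borel g"
  have em: "emeasure N {c} = emeasure \<mu> {x\<in>L. g x = c}" for c
  proof -
    have "emeasure N {c} = emeasure R (g -` {c} \<inter> space R)"
      unfolding N_def using gm by (intro emeasure_distr) auto
    also have "\<dots> = emeasure \<mu> (g -` {c} \<inter> space R)"
      unfolding R_def by (intro emeasure_restrict_space) (auto simp: space_restrict_space spU Ls)
    also have "g -` {c} \<inter> space R = {x\<in>L. g x = c}" unfolding spR by auto
    finally show ?thesis .
  qed
  have "emeasure R (space R) = emeasure \<mu> L"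
    unfolding spR unfolding R_def using Ls by (intro emeasure_restrict_space) (auto simp: spU)
  then have "finite_measure R" using assms(3) by (intro finite_measureI) auto
  then interpret N: finite_measure N
    unfolding N_def using gm by (intro finite_measure.finite_measure_distr)
  show ?thesis
    using N.countable_support by (simp add: em[symmetric] N.emeasure_eq_measure)
qed

lemma exists_uncharged_level:
  fixes g :: "'a::metric_space \<Rightarrow> real"
  assumes "sets \<mu> = sets borel" "L \<in> sets borel" "emeasure \<mu> L < \<infinity>" "continuous_on L g" "a < b"
  shows "\<exists>c. a < c \<and> c < b \<and> emeasure \<mu> {x\<in>L. g x = c} = 0"
proof -
  have "uncountable ({a<..<b} - {c. emeasure \<mu> {x\<in>L. g x = c} \<noteq> 0})"
    using countable_charged_levels[OF assms(1-4)] uncountable_open_interval assms(5)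
    by (intro uncountable_minus_countable) auto
  then have "{a<..<b} - {c. emeasure \<mu> {x\<in>L. g x = c} \<noteq> 0} \<noteq> {}" by force
  then show ?thesis by auto
qed

lemma compact_off_strips:
  fixes \<phi> :: "'k \<Rightarrow> 'a::metric_space \<Rightarrow> real"
  assumes "compact L" "\<And>k. k \<in> J \<Longrightarrow> continuous_on L (\<phi> k)"
  shows "compact {x\<in>L. \<forall>k\<in>J. \<bar>\<phi> k x - c k\<bar> \<ge> \<delta>}"
proof -
  have "closed {x\<in>L. \<bar>\<phi> k x - c k\<bar> \<ge> \<delta>}" if "k \<in> J" for k
    using assms(2)[OF that] compact_imp_closed[OF assms(1)]
    by (intro continuous_on_closed_Collect_le[of L "\<lambda>_. \<delta>", simplified conj_commute] continuous_intros) auto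
  then have "compact (L \<inter> (\<Inter>k\<in>J. {x\<in>L. \<bar>\<phi> k x - c k\<bar> \<ge> \<delta>}))"
    using assms(1) by (intro compact_Int_closed closed_INT) auto
  moreover have "L \<inter> (\<Inter>k\<in>J. {x\<in>L. \<bar>\<phi> k x - c k\<bar> \<ge> \<delta>}) = {x\<in>L. \<forall>k\<in>J. \<bar>\<phi> k x - c k\<bar> \<ge> \<delta>}"
    by auto
  ultimately show ?thesis by simp
qed

text \<open>
  As \<open>\<delta>\<close> decreases to \<open>0\<close>, the points of \<open>L\<close> at which some \<open>\<phi> k\<close> is closer than \<open>\<delta>\<close> to the level \<open>c k\<close>
  decrease to the union of the level sets, which is null.
\<close>

lemma exists_thin_strips:
  fixes \<phi> :: "'k \<Rightarrow> 'a::metric_space \<Rightarrow> real"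
  assumes "sets \<mu> = sets borel" "compact L" "emeasure \<mu> L < \<infinity>" "finite J"
    and cont: "\<And>k. k \<in> J \<Longrightarrow> continuous_on L (\<phi> k)"
    and null: "\<And>k. k \<in> J \<Longrightarrow> emeasure \<mu> {x\<in>L. \<phi> k x = c k} = 0"
    and "e > 0"
  shows "\<exists>\<delta>>0. emeasure \<mu> (L - {x\<in>L. \<forall>k\<in>J. \<bar>\<phi> k x - c k\<bar> \<ge> \<delta>}) < e"
proof -
  define A where "A n = L - {x\<in>L. \<forall>k\<in>J. \<bar>\<phi> k x - c k\<bar> \<ge> 1 / real (Suc n)}" for n
  have Lb: "L \<in> sets \<mu>" using assms(1,2) by (auto intro: borel_compact)
  have A: "A n \<in> sets \<mu>" for n
    unfolding A_def using compact_off_strips[OF assms(2) cont, of J] assms(1)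
    by (intro sets.Diff Lb) (auto intro: borel_compact)
  have fin: "emeasure \<mu> (A n) \<noteq> \<infinity>" for n
    using emeasure_mono[of "A n" L \<mu>] Lb assms(3) by (force simp: A_def top_unique)
  have "decseq A"
    unfolding decseq_def
  proof (intro allI impI)
    fix m n :: nat assume "m \<le> n"
    then have "1 / real (Suc n) \<le> 1 / real (Suc m)" by (simp add: frac_le)
    then show "A n \<subseteq> A m" unfolding A_def using order_trans by blast
  qed
  then have lim: "(\<lambda>n. emeasure \<mu> (A n)) \<longlonglongrightarrow> emeasure \<mu> (\<Inter>n. A n)"
    using A fin by (intro Lim_emeasure_decseq) auto
  have "(\<Inter>n. A n) \<subseteq> (\<Union>k\<in>J. {x\<in>L. \<phi> k x = c k})"
  proof
    fix x assume x: "x \<in> (\<Inter>n. A n)"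
    show "x \<in> (\<Union>k\<in>J. {x\<in>L. \<phi> k x = c k})"
    proof (rule ccontr)
      assume n: "x \<notin> (\<Union>k\<in>J. {x\<in>L. \<phi> k x = c k})"
      have xL: "x \<in> L" using x by (auto simp: A_def)
      define d where "d = Min (insert 1 ((\<lambda>k. \<bar>\<phi> k x - c k\<bar>) ` J))"
      have "d > 0" unfolding d_def using \<open>finite J\<close> n xL by (subst Min_gr_iff) auto
      then obtain m where m: "1 / real (Suc m) < d" using nat_approx_posE by blast
      have "d \<le> \<bar>\<phi> k x - c k\<bar>" if "k \<in> J" for k
        unfolding d_def using \<open>finite J\<close> that by (intro Min_le) auto
      then have "\<forall>k\<in>J. \<bar>\<phi> k x - c k\<bar> \<ge> 1 / real (Suc m)" using m by force
      moreover have "x \<in> A m" using x by blast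
      ultimately show False using xL by (auto simp: A_def)
    qed
  qed
  moreover have "(\<Union>k\<in>J. {x\<in>L. \<phi> k x = c k}) \<in> null_sets \<mu>"
  proof (intro null_sets_UN' countable_finite assms(4))
    fix k assume k: "k \<in> J"
    have "closed {x\<in>L. \<phi> k x = c k}"
      using cont[OF k] compact_imp_closed[OF assms(2)]
      by (intro continuous_closed_preimage_constant)
    then show "{x\<in>L. \<phi> k x = c k} \<in> null_sets \<mu>"
      using null[OF k] assms(1) by (intro null_setsI) auto
  qed
  moreover have "(\<Inter>n. A n) \<in> sets \<mu>" using A by (intro sets.countable_INT) auto
  ultimately have "(\<Inter>n. A n) \<in> null_sets \<mu>" using null_sets_subset by blast
  then have "(\<lambda>n. emeasure \<mu> (A n)) \<longlonglongrightarrow> 0" using lim by (simp add: null_setsD1)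
  then have "\<forall>\<^sub>F n in sequentially. emeasure \<mu> (A n) < e" using \<open>e > 0\<close> by (rule order_tendstoD)
  then obtain n where "emeasure \<mu> (A n) < e" by (auto simp: eventually_sequentially)
  then show ?thesis unfolding A_def by (intro exI[of _ "1 / real (Suc n)"]) auto
qed

section \<open>Approximation on compact sets up to small measure\<close>

lemma compact_openin_indexed_cover:
  assumes "compact D" "\<And>i. i \<in> I \<Longrightarrow> openin (top_of_set D) (V i)" "D \<subseteq> \<Union>(V ` I)"
  obtains J where "finite J" "J \<subseteq> I" "D \<subseteq> \<Union>(V ` J)"
proof -
  have "(\<forall>W\<in>V ` I. openin (top_of_set D) W) \<and> D \<subseteq> \<Union>(V ` I)" using assms(2,3) by blast
  then obtain \<D> where \<D>: "\<D> \<subseteq> V ` I" "finite \<D>" "D \<subseteq> \<Union>\<D>"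
    using assms(1)[unfolded compact_eq_openin_cover, rule_format, of "V ` I"] by blast
  obtain J where "J \<subseteq> I" "finite J" "\<D> = V ` J" using finite_subset_image[OF \<D>(2,1)] by blast
  then show thesis using \<D>(3) that by blast
qed

context function_algebra
begin

lemma exists_separating_real_part:
  assumes "\<forall>x\<in>U. \<forall>y\<in>U. x \<noteq> y \<longrightarrow> (\<exists>f\<in>\<O>. f x \<noteq> f y)" "x \<in> U" "y \<in> U" "x \<noteq> y"
  shows "\<exists>g\<in>\<O>. Re (g x) < Re (g y)"
proof -
  obtain f where f: "f \<in> \<O>" "f x \<noteq> f y" using assms by blast
  define a where "a = cnj (f y - f x)"
  have "Re (a * f x) < Re (a * f y)"
  proof -
    have "Re (a * f y) - Re (a * f x) = (cmod (f y - f x))\<^sup>2"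
      unfolding cmod_power2 by (simp add: a_def power2_eq_square algebra_simps)
    then show ?thesis using f(2) by (smt (verit) zero_less_power2 norm_eq_zero right_minus_eq)
  qed
  then show ?thesis using mult_mem[OF const_mem[of a] f(1)] by (intro bexI[of _ "\<lambda>x. a * f x"]) auto
qed

text \<open>
  The pairs of points at which \<open>h\<close> differs noticeably form a compact set, so finitely many cuts
  \<open>Re g = c\<close> along null level sets separate all of them.  Off thin strips around the cuts, \<open>h\<close> is nearly
  a function of the sides of the cuts on which a point lies, and such functions are approximable.
\<close>

lemma approximate_off_strips:
  fixes \<mu> :: "'a measure" and e \<epsilon> :: real
  assumes sep: "\<forall>x\<in>U. \<forall>y\<in>U. x \<noteq> y \<longrightarrow> (\<exists>f\<in>\<O>. f x \<noteq> f y)"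
    and L: "compact L" "L \<subseteq> U" and \<mu>: "sets \<mu> = sets borel" "emeasure \<mu> L < \<infinity>"
    and h: "continuous_on L h" and "e > 0" "\<epsilon> > 0"
  shows "\<exists>w\<in>\<O>. \<exists>E\<subseteq>L. compact E \<and> emeasure \<mu> (L - E) < ennreal \<epsilon> \<and> (\<forall>x\<in>E. cmod (w x - h x) < e)"
proof -
  have Lb: "L \<in> sets borel" using L by (intro borel_compact)
  have cont: "continuous_on L (\<lambda>x. Re (g x))" if "g \<in> \<O>" for g
    using continuous_on_mem[OF that] L(2) by (intro continuous_intros) (rule continuous_on_subset)
  define D where "D = {z \<in> L \<times> L. e / 2 \<le> cmod (h (fst z) - h (snd z))}"
  have cont_pair: "continuous_on (L \<times> L) (\<lambda>z. k (fst z))" "continuous_on (L \<times> L) (\<lambda>z. k (snd z))"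
    if "continuous_on L k" for k :: "'a \<Rightarrow> 'b::topological_space"
    using that by (auto intro!: continuous_on_compose2[of L k] continuous_intros)
  have "compact D"
  proof -
    have "closed D" unfolding D_def
      using L(1) by (intro continuous_on_closed_Collect_le continuous_intros cont_pair h compact_imp_closed compact_Times)
    moreover have "D = (L \<times> L) \<inter> D" by (auto simp: D_def)
    ultimately show ?thesis using L(1) by (metis compact_Int_closed compact_Times)
  qed
  \<comment> \<open>The pairs of points on opposite sides of the cut \<open>Re g = c\<close>, where \<open>p = (g, c)\<close>.\<close>
  define V where "V p = {z \<in> D. (Re (fst p (fst z)) - snd p) * (Re (fst p (snd z)) - snd p) < 0}"
    for p :: "('a \<Rightarrow> complex) \<times> real"
  define I where "I = {p. fst p \<in> \<O> \<and> emeasure \<mu> {x\<in>L. Re (fst p x) = snd p} = 0}"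
  have "openin (top_of_set D) (V p)" if "p \<in> I" for p
  proof -
    have "continuous_on D (\<lambda>z. (Re (fst p (fst z)) - snd p) * (Re (fst p (snd z)) - snd p))"
      using that by (intro continuous_on_subset[of "L \<times> L" _ D] continuous_intros cont_pair cont) (auto simp: I_def D_def)
    then have "openin (top_of_set D) (D \<inter> (\<lambda>z. (Re (fst p (fst z)) - snd p) * (Re (fst p (snd z)) - snd p)) -` {..<0})"
      by (rule continuous_openin_preimage_gen) auto
    moreover have "V p = D \<inter> (\<lambda>z. (Re (fst p (fst z)) - snd p) * (Re (fst p (snd z)) - snd p)) -` {..<0}"
      by (auto simp: V_def)
    ultimately show ?thesis by simp
  qed
  moreover have "D \<subseteq> \<Union>(V ` I)"
  proof
    fix z assume z: "z \<in> D"
    then have zL: "fst z \<in> L" "snd z \<in> L" "fst z \<noteq> snd z"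
      using \<open>e > 0\<close> by (auto simp: D_def)
    obtain g where g: "g \<in> \<O>" "Re (g (fst z)) < Re (g (snd z))"
      using exists_separating_real_part[OF sep, of "fst z" "snd z"] zL L(2) by blast
    obtain c where c: "Re (g (fst z)) < c" "c < Re (g (snd z))" "emeasure \<mu> {x\<in>L. Re (g x) = c} = 0"
      using exists_uncharged_level[OF \<mu>(1) Lb \<mu>(2) cont[OF g(1)] g(2)] by blast
    have "(g, c) \<in> I" using g c by (simp add: I_def)
    moreover have "z \<in> V (g, c)" using z c by (simp add: V_def mult_neg_pos)
    ultimately show "z \<in> \<Union>(V ` I)" by blast
  qed
  ultimately obtain J where J: "finite J" "J \<subseteq> I" "D \<subseteq> \<Union>(V ` J)"
    by (rule compact_openin_indexed_cover[OF \<open>compact D\<close>])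
  define \<phi> where "\<phi> p x = Re (fst p x)" for p :: "('a \<Rightarrow> complex) \<times> real" and x
  obtain \<delta> where \<delta>: "\<delta> > 0" "emeasure \<mu> (L - {x\<in>L. \<forall>p\<in>J. \<bar>\<phi> p x - snd p\<bar> \<ge> \<delta>}) < ennreal \<epsilon>"
    using exists_thin_strips[OF \<mu>(1) L(1) \<mu>(2) J(1), of \<phi> snd "ennreal \<epsilon>"] cont J(2) \<open>\<epsilon> > 0\<close>
    by (auto simp: \<phi>_def I_def subset_iff)
  define E where "E = {x\<in>L. \<forall>p\<in>J. \<bar>\<phi> p x - snd p\<bar> \<ge> \<delta>}"
  have "compact E"
    unfolding E_def using L(1) cont J(2) by (intro compact_off_strips) (auto simp: \<phi>_def I_def)
  have EL: "E \<subseteq> L" by (auto simp: E_def)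
  interpret E: compact_in_function_algebra \<O> U E
    using \<open>compact E\<close> EL L(2) by unfold_locales auto
  define pat where "pat x = {p \<in> J. Re (fst p x) > snd p}" for x
  \<comment> \<open>The value of \<open>h\<close> at some point of \<open>E\<close> with the given pattern.\<close>
  define F where "F A = h (SOME y. y \<in> E \<and> pat y = A)" for A
  have "approximable E (\<lambda>x. F (pat x))"
    unfolding pat_def
  proof (intro E.approximable_pattern[OF J(1)] E.approximable_half_plane[OF _ \<delta>(1)])
    fix p assume "p \<in> J"
    then show "fst p \<in> \<O>" using J(2) by (auto simp: I_def)
    show "\<delta> \<le> \<bar>Re (fst p x) - snd p\<bar>" if "x \<in> E" for x
      using that \<open>p \<in> J\<close> by (auto simp: E_def \<phi>_def)
  qed
  then obtain w where w: "w \<in> \<O>" "\<forall>x\<in>E. cmod (w x - F (pat x)) < e / 2"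
    using \<open>e > 0\<close> by (elim approximableE[of _ _ "e / 2"]) auto
  have "cmod (w x - h x) < e" if "x \<in> E" for x
  proof -
    define y where "y = (SOME y. y \<in> E \<and> pat y = pat x)"
    have y: "y \<in> E" "pat y = pat x"
      using someI[of "\<lambda>y. y \<in> E \<and> pat y = pat x" x] that by (auto simp: y_def)
    have "cmod (h y - h x) < e / 2"
    proof (rule ccontr)
      assume "\<not> ?thesis"
      then have "(y, x) \<in> D" using y that EL by (auto simp: D_def)
      then obtain p where p: "p \<in> J" "(Re (fst p y) - snd p) * (Re (fst p x) - snd p) < 0"
        using J(3) by (auto simp: V_def)
      then have "(p \<in> pat y) \<noteq> (p \<in> pat x)"
        by (auto simp: pat_def mult_less_0_iff)
      then show False using y by simp
    qed
    moreover have "F (pat x) = h y" by (simp add: F_def y_def)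
    ultimately show ?thesis using w(2) that norm_triangle_ineq[of "w x - h y" "h y - h x"] by fastforce
  qed
  then show ?thesis using w(1) \<open>compact E\<close> EL \<delta>(2) by (auto simp: E_def[symmetric])
qed

text \<open>Twice a high power of \<open>f / f x\<close>, unless \<open>K\<close> is empty, when \<open>b\<close> may be negative and \<open>f x\<close> zero.\<close>

lemma exists_peak_function:
  assumes "f \<in> \<O>" "\<forall>y\<in>K. cmod (f y) \<le> b" "b < cmod (f x)"
  shows "\<exists>\<phi>\<in>\<O>. (\<forall>y\<in>K. cmod (\<phi> y) \<le> 1 / 8) \<and> Re (\<phi> x) > 1"
proof (cases "K = {}")
  case True
  then show ?thesis by (intro bexI[of _ "\<lambda>_. 2"] const_mem) auto
next
  case False
  then have "b \<ge> 0" using assms(2) norm_ge_zero order_trans by blast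
  then have fx: "cmod (f x) > 0" using assms(3) by linarith
  then have "b / cmod (f x) < 1" using assms(3) by simp
  then obtain n where n: "(b / cmod (f x)) ^ n < 1 / 16"
    using real_arch_pow_inv[of "1 / 16" "b / cmod (f x)"] by auto
  define \<phi> where "\<phi> y = 2 * (1 / f x * f y) ^ n" for y
  have "\<phi> \<in> \<O>" unfolding \<phi>_def using assms(1) by (intro mult_mem const_mem power_mem)
  moreover have "cmod (\<phi> y) \<le> 1 / 8" if "y \<in> K" for y
  proof -
    have "cmod (\<phi> y) = 2 * (cmod (f y) / cmod (f x)) ^ n"
      by (simp add: \<phi>_def norm_mult norm_power norm_divide)
    also have "\<dots> \<le> 2 * (b / cmod (f x)) ^ n"
      using assms(2) that by (intro mult_left_mono power_mono divide_right_mono) auto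
    finally show ?thesis using n by simp
  qed
  moreover have "\<phi> x = 2" using fx by (simp add: \<phi>_def)
  ultimately show ?thesis by (intro bexI[of _ \<phi>]) auto
qed

text \<open>
  The substitute for the Oka--Weil theorem.  Each point of \<open>L - K\<close> has a member of \<open>\<O>\<close> that is small on all
  of \<open>K\<close> and has real part greater than \<open>1\<close> at the point.  Cutting along levels \<open>c\<close> between \<open>1 / 4\<close> and \<open>1\<close>
  of finitely many such functions never meets \<open>K\<close>, and makes the function that is \<open>0\<close> on \<open>K\<close> and \<open>1\<close> on
  the rest approximable.  Its product with a member of \<open>\<O>\<close> close to \<open>h\<close> is what is needed.
\<close>

lemma approximate_extending_zero:
  fixes \<mu> :: "'a measure" and e \<epsilon> :: real
  assumes sep: "\<forall>x\<in>U. \<forall>y\<in>U. x \<noteq> y \<longrightarrow> (\<exists>f\<in>\<O>. f x \<noteq> f y)"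
    and K: "compact K" "K \<subseteq> U"
    and convex: "\<forall>x\<in>U - K. \<exists>f\<in>\<O>. \<exists>b. (\<forall>y\<in>K. cmod (f y) \<le> b) \<and> b < cmod (f x)"
    and L: "compact L" "L \<subseteq> U"
    and \<mu>: "regular_borel_measure_on UNIV \<mu>"
    and h: "continuous_on L h" and "e > 0" "\<epsilon> > 0"
  shows "\<exists>g\<in>\<O>. \<exists>E\<subseteq>L - K. compact E \<and> emeasure \<mu> (L - K - E) \<le> ennreal \<epsilon> \<and>
    (\<forall>x\<in>K. cmod (g x) < e) \<and> (\<forall>x\<in>E. cmod (g x - h x) < e)"
proof -
  have sets: "sets \<mu> = sets borel" using regular_borel_sets_UNIV[OF \<mu>] .
  have compact_sets: "C \<in> sets \<mu>" if "compact C" for C using sets that by (auto intro: borel_compact)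
  have fin: "emeasure \<mu> C < \<infinity>" if "compact C" for C
    using \<mu> that by (auto simp: regular_borel_measure_on_def)
  have "emeasure \<mu> (L - K) < \<infinity>"
    using emeasure_mono[of "L - K" L \<mu>] fin[OF L(1)] compact_sets[OF L(1)] by (auto intro: le_less_trans)
  moreover have "L - K \<in> sets \<mu>" using compact_sets[OF L(1)] compact_sets[OF K(1)] by (rule sets.Diff)
  moreover have "\<epsilon> / 3 > 0" using \<open>\<epsilon> > 0\<close> by simp
  ultimately obtain L1 where L1: "compact L1" "L1 \<subseteq> L - K" "emeasure \<mu> (L - K - L1) < ennreal (\<epsilon> / 3)"
    using regular_borel_inner_compact[OF \<mu>] by metis
  have "continuous_on L1 h" using h L1(2) by (meson Diff_subset continuous_on_subset subset_trans)
  moreover have L1U: "L1 \<subseteq> U" using L1(2) L(2) by blast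
  ultimately obtain w E1 where w: "w \<in> \<O>" "\<forall>x\<in>E1. cmod (w x - h x) < e / 2"
    and E1: "E1 \<subseteq> L1" "compact E1" "emeasure \<mu> (L1 - E1) < ennreal (\<epsilon> / 3)"
    using approximate_off_strips[OF sep L1(1) _ sets fin[OF L1(1)], of h "e / 2" "\<epsilon> / 3"] \<open>e > 0\<close> \<open>\<epsilon> > 0\<close>
    by auto
  have E1U: "E1 \<subseteq> U" using E1(1) L1U by blast
  have cont: "continuous_on E1 (\<lambda>x. Re (g x))" if "g \<in> \<O>" for g
    using continuous_on_mem[OF that] E1U by (intro continuous_intros) (rule continuous_on_subset)
  define \<Phi> where "\<Phi> = {\<phi>\<in>\<O>. \<forall>y\<in>K. cmod (\<phi> y) \<le> 1 / 8}"
  have "openin (top_of_set E1) {x\<in>E1. Re (\<phi> x) > 1}" if "\<phi> \<in> \<Phi>" for \<phi>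
  proof -
    have "openin (top_of_set E1) (E1 \<inter> (\<lambda>x. Re (\<phi> x)) -` {1<..})"
      using continuous_openin_preimage_gen[OF cont, of \<phi> "{1<..}"] that by (simp add: \<Phi>_def)
    moreover have "{x\<in>E1. Re (\<phi> x) > 1} = E1 \<inter> (\<lambda>x. Re (\<phi> x)) -` {1<..}" by auto
    ultimately show ?thesis by simp
  qed
  moreover have "E1 \<subseteq> \<Union>((\<lambda>\<phi>. {x\<in>E1. Re (\<phi> x) > 1}) ` \<Phi>)"
  proof
    fix x assume x: "x \<in> E1"
    then have "x \<in> U - K" using E1(1) L1(2) L(2) by blast
    then obtain f b where "f \<in> \<O>" "\<forall>y\<in>K. cmod (f y) \<le> b" "b < cmod (f x)" using convex by blast
    from exists_peak_function[OF this] show "x \<in> \<Union>((\<lambda>\<phi>. {x\<in>E1. Re (\<phi> x) > 1}) ` \<Phi>)"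
      using x by (auto simp: \<Phi>_def)
  qed
  ultimately obtain J where J: "finite J" "J \<subseteq> \<Phi>" "E1 \<subseteq> \<Union>((\<lambda>\<phi>. {x\<in>E1. Re (\<phi> x) > 1}) ` J)"
    by (rule compact_openin_indexed_cover[OF E1(2)])
  have "\<exists>c. 1 / 4 < c \<and> c < 1 \<and> emeasure \<mu> {x\<in>E1. Re (\<phi> x) = c} = 0" if "\<phi> \<in> \<O>" for \<phi>
    using exists_uncharged_level[OF sets _ fin[OF E1(2)] cont[OF that], of "1 / 4" 1] E1(2)
    by (auto intro: borel_compact)
  then obtain c where c: "\<And>\<phi>. \<phi> \<in> \<O> \<Longrightarrow> 1 / 4 < c \<phi> \<and> c \<phi> < 1 \<and> emeasure \<mu> {x\<in>E1. Re (\<phi> x) = c \<phi>} = 0"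
    by metis
  obtain \<delta> where \<delta>: "\<delta> > 0" "emeasure \<mu> (E1 - {x\<in>E1. \<forall>\<phi>\<in>J. \<bar>Re (\<phi> x) - c \<phi>\<bar> \<ge> \<delta>}) < ennreal (\<epsilon> / 3)"
    using exists_thin_strips[OF sets E1(2) fin[OF E1(2)] J(1), of "\<lambda>\<phi> x. Re (\<phi> x)" c "ennreal (\<epsilon> / 3)"]
      cont J(2) c \<open>\<epsilon> > 0\<close> by (auto simp: \<Phi>_def subset_iff)
  define E where "E = {x\<in>E1. \<forall>\<phi>\<in>J. \<bar>Re (\<phi> x) - c \<phi>\<bar> \<ge> \<delta>}"
  have "compact E"
    unfolding E_def using E1(2) cont J(2) by (intro compact_off_strips) (auto simp: \<Phi>_def)
  have EE1: "E \<subseteq> E1" by (auto simp: E_def)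
  then have EL: "E \<subseteq> L - K" using E1(1) L1(2) by blast
  interpret X: compact_in_function_algebra \<O> U "K \<union> E"
    using \<open>compact E\<close> EL L(2) K by unfold_locales (auto intro: compact_Un)
  define pat where "pat x = {\<phi>\<in>J. Re (\<phi> x) > c \<phi>}" for x
  \<comment> \<open>\<open>F (pat x)\<close> is \<open>0\<close> on \<open>K\<close> and \<open>1\<close> on \<open>E\<close>.\<close>
  define F :: "('a \<Rightarrow> complex) set \<Rightarrow> complex" where "F A = of_bool (A \<noteq> {})" for A
  have small: "Re (\<phi> x) \<le> 1 / 8" if "\<phi> \<in> J" "x \<in> K" for \<phi> x
    using J(2) that complex_Re_le_cmod[of "\<phi> x"] by (force simp: \<Phi>_def)
  have J\<O>: "\<phi> \<in> \<O>" if "\<phi> \<in> J" for \<phi> using J(2) that by (auto simp: \<Phi>_def)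
  have "approximable (K \<union> E) (\<lambda>x. F (pat x))"
    unfolding pat_def
  proof (intro X.approximable_pattern[OF J(1)] X.approximable_half_plane[where \<delta> = "min \<delta> (1 / 8)"])
    fix \<phi> assume \<phi>: "\<phi> \<in> J"
    then show "\<phi> \<in> \<O>" by (rule J\<O>)
    show "min \<delta> (1 / 8) \<le> \<bar>Re (\<phi> x) - c \<phi>\<bar>" if "x \<in> K \<union> E" for x
      using that
    proof
      assume "x \<in> K"
      then show ?thesis using small[OF \<phi>] c[OF J\<O>[OF \<phi>]] by fastforce
    next
      assume "x \<in> E"
      then show ?thesis using \<phi> by (auto simp: E_def)
    qed
  qed (use \<delta> in auto)
  then have "approximable (K \<union> E) (\<lambda>x. w x * F (pat x))"
    using w(1) by (intro X.mult[OF approximable_mem])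
  then obtain g where g: "g \<in> \<O>" "\<forall>x\<in>K \<union> E. cmod (g x - w x * F (pat x)) < e / 2"
    using \<open>e > 0\<close> by (elim approximableE[of _ _ "e / 2"]) auto
  have "cmod (g x) < e" if "x \<in> K" for x
  proof -
    have "\<not> Re (\<phi> x) > c \<phi>" if "\<phi> \<in> J" for \<phi>
      using small[OF that \<open>x \<in> K\<close>] c[OF J\<O>[OF that]] by linarith
    then have "F (pat x) = 0" by (auto simp: F_def pat_def)
    moreover have "cmod (g x - w x * F (pat x)) < e / 2" using g(2) \<open>x \<in> K\<close> by blast
    ultimately show ?thesis using \<open>e > 0\<close> by simp
  qed
  moreover have "cmod (g x - h x) < e" if "x \<in> E" for x
  proof -
    obtain \<phi> where "\<phi> \<in> J" "Re (\<phi> x) > 1" using J(3) EE1 \<open>x \<in> E\<close> by blast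
    then have "F (pat x) = 1" using c[OF J\<O>] by (fastforce simp: F_def pat_def)
    moreover have "cmod (g x - w x * F (pat x)) < e / 2" using g(2) that by blast
    ultimately have "cmod (g x - w x) < e / 2" by simp
    moreover have "cmod (w x - h x) < e / 2" using w(2) that EE1 by blast
    ultimately show ?thesis using norm_triangle_ineq[of "g x - w x" "w x - h x"] by simp
  qed
  moreover have "emeasure \<mu> (L - K - E) \<le> ennreal \<epsilon>"
  proof -
    have "emeasure \<mu> (L - K - E) \<le> emeasure \<mu> ((L - K - L1) \<union> (L1 - E1) \<union> (E1 - E))"
      using compact_sets[OF L(1)] compact_sets[OF K(1)] compact_sets[OF L1(1)] compact_sets[OF E1(2)]
        compact_sets[OF \<open>compact E\<close>] by (intro emeasure_mono) auto
    also have "\<dots> \<le> emeasure \<mu> (L - K - L1) + emeasure \<mu> (L1 - E1) + emeasure \<mu> (E1 - E)"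
      using compact_sets[OF L(1)] compact_sets[OF K(1)] compact_sets[OF L1(1)] compact_sets[OF E1(2)]
        compact_sets[OF \<open>compact E\<close>]
      by (intro order_trans[OF emeasure_subadditive] add_mono emeasure_subadditive order_refl) auto
    also have "\<dots> \<le> ennreal (\<epsilon> / 3) + ennreal (\<epsilon> / 3) + ennreal (\<epsilon> / 3)"
      using L1(3) E1(3) \<delta>(2) by (intro add_mono less_imp_le) (auto simp: E_def)
    also have "\<dots> = ennreal \<epsilon>"
      using \<open>\<epsilon> > 0\<close> by (simp add: ennreal_plus[symmetric] del: ennreal_plus)
    finally show ?thesis .
  qed
  ultimately show ?thesis using g(1) EL \<open>compact E\<close> by blast
qed

end

section \<open>Uniform limits of holomorphic functions of several variables\<close>

lemma holomorphic_Cn_on_const: "holomorphic_Cn_on (\<lambda>_. c) S"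
  unfolding holomorphic_Cn_on_def by (intro ballI exI[of _ "\<lambda>_. 0"]) auto

lemma holomorphic_Cn_on_add:
  assumes "holomorphic_Cn_on f S" "holomorphic_Cn_on g S"
  shows "holomorphic_Cn_on (\<lambda>z. f z + g z) S"
  unfolding holomorphic_Cn_on_def
proof
  fix z assume "z \<in> S"
  with assms obtain D D' where
    "(f has_derivative D) (at z)" "\<forall>c v. D (c *s v) = c * D v"
    "(g has_derivative D') (at z)" "\<forall>c v. D' (c *s v) = c * D' v"
    unfolding holomorphic_Cn_on_def by metis
  then show "\<exists>D. ((\<lambda>z. f z + g z) has_derivative D) (at z) \<and> (\<forall>c v. D (c *s v) = c * D v)"
    by (intro exI[of _ "\<lambda>h. D h + D' h"] conjI has_derivative_add) (auto simp: distrib_left)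
qed

lemma holomorphic_Cn_on_mult:
  assumes "holomorphic_Cn_on f S" "holomorphic_Cn_on g S"
  shows "holomorphic_Cn_on (\<lambda>z. f z * g z) S"
  unfolding holomorphic_Cn_on_def
proof
  fix z assume "z \<in> S"
  with assms obtain D D' where
    "(f has_derivative D) (at z)" "\<forall>c v. D (c *s v) = c * D v"
    "(g has_derivative D') (at z)" "\<forall>c v. D' (c *s v) = c * D' v"
    unfolding holomorphic_Cn_on_def by metis
  then show "\<exists>D. ((\<lambda>z. f z * g z) has_derivative D) (at z) \<and> (\<forall>c v. D (c *s v) = c * D v)"
    by (intro exI[of _ "\<lambda>h. f z * D' h + D h * g z"] conjI has_derivative_mult) (auto simp: distrib_left)
qed

lemma norm_vector_smult: "norm (c *s (v :: complex ^ 'n::finite)) = cmod c * norm v"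
  by (simp add: norm_vec_def norm_mult L2_set_right_distrib)

lemma bounded_linear_vector_smult: "bounded_linear (\<lambda>c. c *s (v :: complex ^ 'n::finite))"
  by (intro bounded_linear_intro[where K = "norm v"])
    (auto simp: norm_vector_smult vec_eq_iff algebra_simps)

text \<open>Cauchy's estimate on the complex line through \<open>z\<close> in direction \<open>v\<close>.\<close>

lemma Cauchy_estimate_derivative:
  fixes f :: "complex ^ 'n::finite \<Rightarrow> complex"
  assumes f: "holomorphic_Cn_on f (ball z r)" and "r > 0"
    and bound: "\<And>y. y \<in> ball z r \<Longrightarrow> cmod (f y) \<le> B"
    and D: "(f has_derivative D) (at z)" "\<And>c v. D (c *s v) = c * D v"
  shows "cmod (D v) \<le> 2 * B / r * norm v"
proof (cases "v = 0")
  case True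
  then show ?thesis using D(2)[of 0 0] by simp
next
  case False
  define s where "s = r / (2 * norm v)"
  have "s > 0" using False \<open>r > 0\<close> by (simp add: s_def)
  define l where "l \<zeta> = z + \<zeta> *s v" for \<zeta>
  have l_in: "l \<zeta> \<in> ball z r" if "\<zeta> \<in> cball 0 s" for \<zeta>
  proof -
    have "cmod \<zeta> * norm v \<le> s * norm v" using that by (intro mult_right_mono) auto
    also have "\<dots> < r" using False \<open>r > 0\<close> by (simp add: s_def)
    finally show ?thesis by (simp add: l_def dist_norm norm_vector_smult)
  qed
  have dl: "(l has_derivative (\<lambda>h. h *s v)) (at \<zeta>)" for \<zeta>
    unfolding l_def by (auto intro!: derivative_eq_intros bounded_linear_imp_has_derivative bounded_linear_vector_smult)
  have df: "((\<lambda>\<zeta>. f (l \<zeta>)) has_field_derivative D' v) (at \<zeta>)"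
    if "(f has_derivative D') (at (l \<zeta>))" "\<And>c v. D' (c *s v) = c * D' v" for D' \<zeta>
    using has_derivative_compose[OF dl that(1)] that(2)
    by (simp add: has_field_derivative_def mult_commute_abs)
  have hol: "\<exists>d. ((\<lambda>\<zeta>. f (l \<zeta>)) has_field_derivative d) (at \<zeta>)" if "\<zeta> \<in> cball 0 s" for \<zeta>
    using f l_in[OF that] df unfolding holomorphic_Cn_on_def by metis
  have "cmod ((deriv ^^ 1) (\<lambda>\<zeta>. f (l \<zeta>)) 0) \<le> fact 1 * B / s ^ 1"
  proof (rule Cauchy_inequality)
    show "(\<lambda>\<zeta>. f (l \<zeta>)) holomorphic_on ball 0 s"
      unfolding holomorphic_on_def
    proof
      fix \<zeta> :: complex assume "\<zeta> \<in> ball 0 s"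
      then obtain d where "((\<lambda>\<zeta>. f (l \<zeta>)) has_field_derivative d) (at \<zeta>)" using hol[of \<zeta>] by auto
      then show "(\<lambda>\<zeta>. f (l \<zeta>)) field_differentiable at \<zeta> within ball 0 s"
        using has_field_derivative_at_within field_differentiable_def by blast
    qed
    show "continuous_on (cball 0 s) (\<lambda>\<zeta>. f (l \<zeta>))"
      using hol DERIV_isCont by (intro continuous_at_imp_continuous_on ballI) blast
    show "cmod (f (l x)) \<le> B" if "cmod (0 - x) = s" for x
      using that by (intro bound l_in) auto
  qed fact
  moreover have "((\<lambda>\<zeta>. f (l \<zeta>)) has_field_derivative D v) (at 0)"
    using D by (intro df) (auto simp: l_def)
  ultimately have "cmod (D v) \<le> B / s" by (simp add: DERIV_imp_deriv)
  also have "\<dots> = 2 * B / r * norm v" by (simp add: s_def)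
  finally show ?thesis .
qed

text \<open>
  Weierstrass' theorem.  By Cauchy's estimate the differentials are uniformly Cauchy on a smaller ball,
  so that termwise differentiation is justified; complex linearity passes to the limit.
\<close>

lemma holomorphic_Cn_on_uniform_limit:
  fixes f :: "nat \<Rightarrow> complex ^ 'n::finite \<Rightarrow> complex"
  assumes hol: "\<And>k. holomorphic_Cn_on (f k) S"
    and unif: "\<And>z. z \<in> S \<Longrightarrow> \<exists>r>0. ball z r \<subseteq> S \<and> uniform_limit (ball z r) f g sequentially"
  shows "holomorphic_Cn_on g S"
  unfolding holomorphic_Cn_on_def
proof
  fix z assume "z \<in> S"
  then obtain r where r: "r > 0" "ball z r \<subseteq> S" "uniform_limit (ball z r) f g sequentially"
    using unif by blast
  define D where "D k x = (SOME D. (f k has_derivative D) (at x) \<and> (\<forall>c v. D (c *s v) = c * D v))" for k x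
  have D': "(f k has_derivative D k x) (at x) \<and> (\<forall>c v. D k x (c *s v) = c * D k x v)"
    if "x \<in> ball z r" for k x
  proof -
    have "x \<in> S" using r(2) that by blast
    then show ?thesis
      unfolding D_def by (intro someI_ex[of "\<lambda>D. (f k has_derivative D) (at x) \<and> (\<forall>c v. D (c *s v) = c * D v)"]
        hol[of k, unfolded holomorphic_Cn_on_def, rule_format])
  qed
  have D: "(f k has_derivative D k x) (at x)" "D k x (c *s v) = c * D k x v" if "x \<in> ball z r" for k x c v
    using D'[OF that] by blast+
  define S' where "S' = ball z (r / 2)"
  have S': "x \<in> ball z r" "ball x (r / 2) \<subseteq> ball z r" if "x \<in> S'" for x
  proof -
    show "x \<in> ball z r" using that r(1) by (auto simp: S'_def)
    show "ball x (r / 2) \<subseteq> ball z r"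
    proof
      fix y assume "y \<in> ball x (r / 2)"
      then show "y \<in> ball z r" using that dist_triangle[of z y x] by (auto simp: S'_def)
    qed
  qed
  have diff: "cmod (D m x v - D k x v) \<le> 2 * B / (r / 2) * norm v"
    if "x \<in> S'" and B: "\<And>y. y \<in> ball z r \<Longrightarrow> cmod (f m y - f k y) \<le> B" for m k x v B
  proof -
    have "holomorphic_Cn_on (\<lambda>y. f m y + (- 1) * f k y) (ball x (r / 2))"
      using hol r(2) S'[OF that(1)]
      by (intro holomorphic_Cn_on_add holomorphic_Cn_on_mult holomorphic_Cn_on_const)
        (force simp: holomorphic_Cn_on_def)+
    then have "holomorphic_Cn_on (\<lambda>y. f m y - f k y) (ball x (r / 2))" by simp
    then show ?thesis
      using S'[OF that(1)] r(1) D
      by (intro Cauchy_estimate_derivative[where f = "\<lambda>y. f m y - f k y" and z = x and D = "\<lambda>v. D m x v - D k x v"] B)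
        (auto intro!: derivative_intros simp: algebra_simps)
  qed
  have cauchy: "\<exists>N. \<forall>m\<ge>N. \<forall>k\<ge>N. \<forall>x\<in>S'. \<forall>v. cmod (D m x v - D k x v) \<le> e * norm v" if "e > 0" for e
  proof -
    have "\<exists>N. \<forall>n\<ge>N. \<forall>x\<in>ball z r. dist (f n x) (g x) < e * r / 8"
      using uniform_limitD[OF r(3), of "e * r / 8"] that r(1) by (simp add: eventually_sequentially)
    then obtain N where N: "\<And>n x. n \<ge> N \<Longrightarrow> x \<in> ball z r \<Longrightarrow> dist (f n x) (g x) < e * r / 8" by blast
    have "cmod (D m x v - D k x v) \<le> e * norm v" if "m \<ge> N" "k \<ge> N" "x \<in> S'" for m k x v
    proof -
      have "cmod (f m y - f k y) \<le> e * r / 4" if "y \<in> ball z r" for y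
        using N[OF \<open>m \<ge> N\<close> that] N[OF \<open>k \<ge> N\<close> that] dist_triangle2[of "f m y" "f k y" "g y"]
        by (simp add: dist_norm)
      from diff[OF \<open>x \<in> S'\<close> this, of v] show ?thesis using r(1) by simp
    qed
    then show ?thesis by blast
  qed
  have "\<exists>l. (\<lambda>k. D k x v) \<longlonglongrightarrow> l" if "x \<in> S'" for x v
  proof -
    have "Cauchy (\<lambda>k. D k x v)"
      unfolding Cauchy_iff
    proof (intro allI impI)
      fix e :: real assume "e > 0"
      then have "e / (norm v + 1) > 0" by (simp add: add_nonneg_pos)
      from cauchy[OF this] obtain N where
        N: "\<And>m k. m \<ge> N \<Longrightarrow> k \<ge> N \<Longrightarrow> cmod (D m x v - D k x v) \<le> e / (norm v + 1) * norm v"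
        using \<open>x \<in> S'\<close> by blast
      have "e / (norm v + 1) * norm v < e"
        using \<open>e > 0\<close> by (simp add: divide_simps add_nonneg_pos)
      then show "\<exists>M. \<forall>m\<ge>M. \<forall>n\<ge>M. cmod (D m x v - D n x v) < e" using N by (meson le_less_trans)
    qed
    then show ?thesis by (simp add: Cauchy_convergent_iff convergent_def)
  qed
  then obtain D' where D': "\<And>x v. x \<in> S' \<Longrightarrow> (\<lambda>k. D k x v) \<longlonglongrightarrow> D' x v" by metis
  have zS': "z \<in> S'" using r(1) by (simp add: S'_def)
  have "\<exists>G. \<forall>x\<in>S'. (\<lambda>n. f n x) \<longlonglongrightarrow> G x \<and> (G has_derivative D' x) (at x within S')"
  proof (rule has_derivative_sequence)
    show "convex S'" by (simp add: S'_def)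
    show "(f n has_derivative D n x) (at x within S')" if "x \<in> S'" for n x
      using D(1)[OF S'(1)[OF that]] by (rule has_derivative_at_withinI)
    show "z \<in> S'" by fact
    show "(\<lambda>n. f n z) \<longlonglongrightarrow> g z" using tendsto_uniform_limitI[OF r(3)] r(1) by simp
    show "\<forall>\<^sub>F n in sequentially. \<forall>x\<in>S'. \<forall>h. cmod (D n x h - D' x h) \<le> e * norm h" if "e > 0" for e
    proof -
      obtain N where N: "\<And>m k x v. m \<ge> N \<Longrightarrow> k \<ge> N \<Longrightarrow> x \<in> S' \<Longrightarrow> cmod (D m x v - D k x v) \<le> e * norm v"
        using cauchy[OF \<open>e > 0\<close>] by blast
      have "cmod (D n x h - D' x h) \<le> e * norm h" if "n \<ge> N" "x \<in> S'" for n x h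
      proof (rule tendsto_upperbound)
        show "(\<lambda>k. cmod (D n x h - D k x h)) \<longlonglongrightarrow> cmod (D n x h - D' x h)"
          using D'[OF that(2)] by (intro tendsto_intros)
        show "\<forall>\<^sub>F k in sequentially. cmod (D n x h - D k x h) \<le> e * norm h"
          using N[OF that(1) _ that(2)] by (auto simp: eventually_sequentially)
      qed auto
      then show ?thesis by (auto simp: eventually_sequentially)
    qed
  qed
  then obtain G where G: "\<And>x. x \<in> S' \<Longrightarrow> (\<lambda>n. f n x) \<longlonglongrightarrow> G x" "\<And>x. x \<in> S' \<Longrightarrow> (G has_derivative D' x) (at x within S')"
    by blast
  have "G x = g x" if "x \<in> S'" for x
    using G(1)[OF that] tendsto_uniform_limitI[OF r(3) S'(1)[OF that]] by (rule LIMSEQ_unique)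
  moreover have "(G has_derivative D' z) (at z)"
    using G(2)[OF zS'] zS' at_within_open[of z S'] by (simp add: S'_def)
  ultimately have "(g has_derivative D' z) (at z)"
    using has_derivative_transform_within_open[of G "D' z" z UNIV S' g] zS' by (auto simp: S'_def)
  moreover have "D' z (c *s v) = c * D' z v" for c v
  proof (rule LIMSEQ_unique)
    show "(\<lambda>k. D k z (c *s v)) \<longlonglongrightarrow> D' z (c *s v)" using D'[OF zS'] .
    show "(\<lambda>k. D k z (c *s v)) \<longlonglongrightarrow> c * D' z v"
      using D'[OF zS', of v] D(2)[OF S'(1)[OF zS']] by (auto intro: tendsto_intros)
  qed
  ultimately show "\<exists>D. (g has_derivative D) (at z) \<and> (\<forall>c v. D (c *s v) = c * D v)" by blast
qed

section \<open>Exhaustions by compact sets\<close>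

text \<open>
  A connected locally compact metric space has an exhaustion by compact sets.  Let \<open>\<rho> x\<close> be the supremum
  of the radii \<open>r \<le> 1\<close> of compact closed balls about \<open>x\<close>, a function with Lipschitz constant \<open>1\<close>.  The union of
  the balls of radius \<open>\<rho> x / 2\<close> about the points \<open>x\<close> of a compact set lies in a compact set, and the union of
  the compact sets produced by iterating this is open and closed.
\<close>

lemma connected_locally_compact_imp_sigma_compact:
  assumes conn: "connected (UNIV :: 'a::metric_space set)"
    and loc: "\<And>x::'a. \<exists>r>0. compact (cball x r)"
  shows "\<exists>C :: nat \<Rightarrow> 'a set. (\<forall>n. compact (C n) \<and> C n \<subseteq> interior (C (Suc n))) \<and> (\<Union>n. C n) = UNIV"
proof -
  define R where "R x = {r. 0 < r \<and> r \<le> 1 \<and> compact (cball x r)}" for x :: 'a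
  define \<rho> where "\<rho> x = Sup (R x)" for x :: 'a
  have bdd: "bdd_above (R x)" for x by (auto simp: R_def bdd_above_def)
  have ne: "\<exists>r>0. r \<in> R x" for x
  proof -
    obtain r where r: "r > 0" "compact (cball x r)" using loc by blast
    have "compact (cball x r \<inter> cball x (min r 1))" using r by (intro compact_Int_closed) auto
    moreover have "cball x r \<inter> cball x (min r 1) = cball x (min r 1)" by auto
    ultimately show ?thesis using r(1) by (intro exI[of _ "min r 1"]) (auto simp: R_def)
  qed
  have pos: "\<rho> x > 0" for x
    using ne[of x] cSup_upper[OF _ bdd] unfolding \<rho>_def by (meson less_le_trans)
  have cpt: "compact (cball x r)" if "r < \<rho> x" for x r
  proof -
    have "R x \<noteq> {}" using ne[of x] by blast
    then obtain s where s: "s \<in> R x" "r < s"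
      using \<open>r < \<rho> x\<close> less_cSup_iff[OF _ bdd, of x r] unfolding \<rho>_def by blast
    then have "compact (cball x s \<inter> cball x r)" by (intro compact_Int_closed) (auto simp: R_def)
    moreover have "cball x s \<inter> cball x r = cball x r" using s(2) by auto
    ultimately show ?thesis by simp
  qed
  have lip: "\<rho> x - dist x y \<le> \<rho> y" for x y
  proof (rule ccontr)
    assume "\<not> ?thesis"
    then obtain t where t: "\<rho> y < t" "t < \<rho> x - dist x y" using dense[of "\<rho> y" "\<rho> x - dist x y"] by auto
    have "compact (cball x (t + dist x y))" using t by (intro cpt) auto
    then have "compact (cball x (t + dist x y) \<inter> cball y t)" by (intro compact_Int_closed) auto
    moreover have "cball y t \<subseteq> cball x (t + dist x y)"
    proof
      fix z assume "z \<in> cball y t"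
      then show "z \<in> cball x (t + dist x y)" using dist_triangle[of x z y] by auto
    qed
    then have "cball x (t + dist x y) \<inter> cball y t = cball y t" by blast
    ultimately have "compact (cball y t)" by simp
    moreover have "t \<le> 1"
    proof -
      have "\<rho> x \<le> 1" unfolding \<rho>_def using ne[of x] by (intro cSup_least) (auto simp: R_def)
      then show ?thesis using t zero_le_dist[of x y] by linarith
    qed
    ultimately have "t \<in> R y" using t(1) pos[of y] by (auto simp: R_def)
    then have "t \<le> \<rho> y" unfolding \<rho>_def using bdd by (rule cSup_upper)
    then show False using t by simp
  qed
  have step: "\<exists>B. compact B \<and> (\<forall>x\<in>A. ball x (\<rho> x / 2) \<subseteq> B)" if "compact A" for A
  proof -
    have "A \<subseteq> (\<Union>x\<in>A. ball x (\<rho> x / 10))" using pos by force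
    then obtain F where F: "F \<subseteq> A" "finite F" "A \<subseteq> (\<Union>x\<in>F. ball x (\<rho> x / 10))"
      using compactE_image[OF \<open>compact A\<close>, of A "\<lambda>x. ball x (\<rho> x / 10)"] by auto
    define B where "B = (\<Union>x\<in>F. cball x (\<rho> x * 9 / 10))"
    have "compact B" unfolding B_def using F(2) pos
      by (intro compact_UN cpt) auto
    moreover have "ball x (\<rho> x / 2) \<subseteq> B" if "x \<in> A" for x
    proof
      fix z assume z: "z \<in> ball x (\<rho> x / 2)"
      obtain y where y: "y \<in> F" "dist y x < \<rho> y / 10" using F(3) \<open>x \<in> A\<close> by auto
      have "\<rho> x \<le> \<rho> y + dist y x" using lip[of x y] by (simp add: dist_commute)
      then have "dist y z < \<rho> y / 10 + (\<rho> y + \<rho> y / 10) / 2"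
        using z y(2) dist_triangle[of y z x] by auto
      also have "\<dots> \<le> \<rho> y * 9 / 10" using pos[of y] by simp
      finally show "z \<in> B" using y(1) by (force simp: B_def)
    qed
    ultimately show ?thesis by blast
  qed
  then obtain N where N: "\<And>A. compact A \<Longrightarrow> compact (N A) \<and> (\<forall>x\<in>A. ball x (\<rho> x / 2) \<subseteq> N A)"
    by metis
  \<comment> \<open>an arbitrary starting point\<close>
  define a :: 'a where "a = undefined"
  define C where "C n = (N ^^ n) {a}" for n
  have C: "compact (C n)" for n
    by (induction n) (auto simp: C_def N)
  have CS: "ball x (\<rho> x / 2) \<subseteq> C (Suc n)" if "x \<in> C n" for x n
    using N[OF C[of n]] that by (auto simp: C_def)
  have int: "C n \<subseteq> interior (C (Suc n))" for n
  proof
    fix x assume "x \<in> C n"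
    then show "x \<in> interior (C (Suc n))"
      using CS[of x n] pos[of x] by (intro interiorI[of "ball x (\<rho> x / 2)"]) auto
  qed
  define W where "W = (\<Union>n. C n)"
  have "open W"
    unfolding open_contains_ball
  proof
    fix x assume "x \<in> W"
    then obtain n where "x \<in> C n" by (auto simp: W_def)
    from CS[OF this] have "ball x (\<rho> x / 2) \<subseteq> W" by (auto simp: W_def)
    then show "\<exists>e>0. ball x e \<subseteq> W" using pos[of x] by (intro exI[of _ "\<rho> x / 2"]) auto
  qed
  moreover have "closed W"
    unfolding closed_limpt islimpt_approachable
  proof (intro allI impI)
    fix y assume "\<forall>e>0. \<exists>x\<in>W. x \<noteq> y \<and> dist x y < e"
    then obtain x where x: "x \<in> W" "dist x y < \<rho> y / 4" using pos[of y] by (metis zero_less_divide_iff zero_less_numeral)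
    have "\<rho> y - dist y x \<le> \<rho> x" by (rule lip)
    then have "y \<in> ball x (\<rho> x / 2)" using x(2) pos[of y] by (simp add: dist_commute)
    moreover obtain n where "x \<in> C n" using x(1) by (auto simp: W_def)
    ultimately show "y \<in> W" unfolding W_def using CS by blast
  qed
  moreover have "a \<in> W" by (auto simp: W_def C_def intro!: exI[of _ 0])
  ultimately have "W = UNIV" using conn by (auto simp: connected_clopen)
  then show ?thesis using C int by (intro exI[of _ C]) (auto simp: W_def)
qed

lemma open_in_sigma_compact_exhaustion:
  fixes U :: "'a::metric_space set" and C :: "nat \<Rightarrow> 'a set"
  assumes C: "\<And>n. compact (C n)" "\<And>n. C n \<subseteq> interior (C (Suc n))" "(\<Union>n. C n) = UNIV"
    and U: "open U" "a \<in> U" "U \<noteq> UNIV"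
  shows "\<exists>D :: nat \<Rightarrow> 'a set. (\<forall>n. compact (D n) \<and> a \<in> D n \<and> D n \<subseteq> U \<and> D n \<subseteq> interior (D (Suc n))) \<and> (\<Union>n. D n) = U"
proof -
  have "C n \<subseteq> C (Suc n)" for n using C(2) interior_subset by (rule subset_trans)
  then have mono: "C m \<subseteq> C n" if "m \<le> n" for m n using that by (rule lift_Suc_mono_le)
  have ne: "- U \<noteq> {}" using U by auto
  obtain n0 where n0: "a \<in> C n0" using C(3) by blast
  have pos: "infdist x (- U) > 0" if "x \<in> U" for x
    using that U(1) ne by (simp add: infdist_pos_not_in_closed closed_Compl)
  obtain n1 where n1: "1 / real (Suc n1) < infdist a (- U)"
    using pos[OF U(2)] nat_approx_posE by blast
  define k where "k = n0 + n1"
  define D where "D n = C (n + k) \<inter> {x. infdist x (- U) \<ge> 1 / real (Suc (n + k))}" for n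
  have "closed {x. infdist x (- U) \<ge> e}" for e
    by (intro closed_Collect_le continuous_intros)
  then have "compact (D n)" for n unfolding D_def using C(1) by (intro compact_Int_closed)
  moreover have "a \<in> D n" for n
  proof -
    have "1 / real (Suc (n + k)) \<le> 1 / real (Suc n1)" by (intro divide_left_mono) (auto simp: k_def)
    then show ?thesis using n1 n0 mono[of n0 "n + k"] by (auto simp: D_def k_def)
  qed
  moreover have "D n \<subseteq> U" for n
  proof
    fix x assume "x \<in> D n"
    then have "infdist x (- U) \<noteq> 0" by (auto simp: D_def)
    then show "x \<in> U" using infdist_zero[of x "- U"] by blast
  qed
  moreover have "D n \<subseteq> interior (D (Suc n))" for n
  proof
    fix x assume x: "x \<in> D n"
    show "x \<in> interior (D (Suc n))"
    proof (rule interiorI[of "interior (C (Suc n + k)) \<inter> {x. infdist x (- U) > 1 / real (Suc (Suc n + k))}"])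
      show "open (interior (C (Suc n + k)) \<inter> {x. infdist x (- U) > 1 / real (Suc (Suc n + k))})"
        by (intro open_Int open_interior open_Collect_less continuous_intros)
      have "1 / real (Suc (Suc n + k)) < 1 / real (Suc (n + k))" by (intro divide_strict_left_mono) auto
      then show "x \<in> interior (C (Suc n + k)) \<inter> {x. infdist x (- U) > 1 / real (Suc (Suc n + k))}"
        using x C(2)[of "n + k"] by (auto simp: D_def)
      show "interior (C (Suc n + k)) \<inter> {x. infdist x (- U) > 1 / real (Suc (Suc n + k))} \<subseteq> D (Suc n)"
        using interior_subset[of "C (Suc n + k)"] by (force simp: D_def)
    qed
  qed
  moreover have "U \<subseteq> (\<Union>n. D n)"
  proof
    fix x assume "x \<in> U"
    obtain m where m: "x \<in> C m" using C(3) by blast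
    obtain l where l: "1 / real (Suc l) < infdist x (- U)"
      using pos[OF \<open>x \<in> U\<close>] nat_approx_posE by blast
    have "1 / real (Suc (m + l + k)) \<le> 1 / real (Suc l)" by (intro divide_left_mono) auto
    then have "x \<in> D (m + l)" using m l mono[of m "m + l + k"] by (auto simp: D_def)
    then show "x \<in> (\<Union>n. D n)" by blast
  qed
  ultimately show ?thesis by (intro exI[of _ D]) blast
qed

lemma compact_subset_exhaustion:
  fixes D :: "nat \<Rightarrow> 'a::topological_space set"
  assumes "\<And>n. D n \<subseteq> interior (D (Suc n))" "compact K" "K \<subseteq> (\<Union>n. D n)"
  shows "\<exists>n. K \<subseteq> D n"
proof -
  have "D n \<subseteq> D (Suc n)" for n using assms(1) interior_subset by (rule subset_trans)
  then have mono: "D m \<subseteq> D n" if "m \<le> n" for m n using that by (rule lift_Suc_mono_le)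
  have "(\<Union>n. D n) \<subseteq> (\<Union>n\<in>UNIV. interior (D (Suc n)))" by (intro UN_mono subset_refl assms(1))
  then have "K \<subseteq> (\<Union>n\<in>UNIV. interior (D (Suc n)))" using assms(3) by (rule subset_trans[rotated])
  then obtain F where F: "finite F" "K \<subseteq> (\<Union>n\<in>F. interior (D (Suc n)))"
    using compactE_image[OF assms(2), of UNIV "\<lambda>n. interior (D (Suc n))"] by auto
  have "interior (D (Suc n)) \<subseteq> D (Suc (Max F))" if "n \<in> F" for n
    using interior_subset[of "D (Suc n)"] mono[of "Suc n" "Suc (Max F)"] Max_ge[OF F(1) that] by auto
  then have "(\<Union>n\<in>F. interior (D (Suc n))) \<subseteq> D (Suc (Max F))" by (rule UN_least)
  then show ?thesis using F(2) by (blast intro: subset_trans)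
qed

section \<open>Lusin's theorem and Tietze extension\<close>

text \<open>
  Lusin's theorem on a compact set.  For each set \<open>V n\<close> of a countable base, the preimage \<open>P n\<close> in \<open>K\<close> and its
  complement contain compact sets \<open>A n\<close> and \<open>A' n\<close> of almost full measure; on the intersection \<open>T\<close> of all
  \<open>A n \<union> A' n\<close> the preimage of \<open>V n\<close> is relatively open.
\<close>

lemma Lusin_compact:
  fixes \<psi> :: "'a::metric_space \<Rightarrow> complex"
  assumes \<nu>: "regular_borel_measure_on X \<nu>" and \<psi>: "\<psi> \<in> borel_measurable (restrict_space borel X)"
    and K: "compact K" "K \<subseteq> X" and "e > 0"
  shows "\<exists>T\<subseteq>K. compact T \<and> continuous_on T \<psi> \<and> emeasure \<nu> (K - T) \<le> ennreal e"
proof -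
  have sp: "space \<nu> = X" and sets: "sets \<nu> = sets (restrict_space borel X)"
    using \<nu> by (auto simp: regular_borel_measure_on_def)
  have Ks: "K \<in> sets \<nu>" using K by (intro regular_borel_sets[OF \<nu>]) (auto intro: borel_compact)
  have fin: "emeasure \<nu> K < \<infinity>" using \<nu> K by (auto simp: regular_borel_measure_on_def)
  obtain B :: "complex set set" where B: "countable B" "topological_basis B"
    using ex_countable_basis by blast
  have Bne: "B \<noteq> {}" using topological_basis_imp_subbasis topological_basisE[OF B(2) open_UNIV, of 0] by blast
  define V where "V n = from_nat_into B n" for n
  have rV: "range V = B" unfolding V_def using range_from_nat_into[OF Bne B(1)] by (simp add: image_def)
  have Vopen: "open (V n)" for n using rV topological_basis_open[OF B(2)] by blast
  define P where "P n = \<psi> -` V n \<inter> K" for n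
  have P: "P n \<in> sets \<nu>" "K - P n \<in> sets \<nu>" for n
  proof -
    have "\<psi> -` V n \<inter> space (restrict_space borel X) \<in> sets (restrict_space borel X)"
      using \<psi> Vopen by (intro measurable_sets) auto
    then have "\<psi> -` V n \<inter> X \<in> sets \<nu>" by (simp add: sets space_restrict_space)
    moreover have "P n = (\<psi> -` V n \<inter> X) \<inter> K" using K(2) by (auto simp: P_def)
    ultimately show "P n \<in> sets \<nu>" using Ks by auto
    then show "K - P n \<in> sets \<nu>" using Ks by auto
  qed
  have finP: "emeasure \<nu> Y < \<infinity>" if "Y \<subseteq> K" for Y
    using emeasure_mono[OF that Ks] fin by (rule le_less_trans)
  define d where "d n = e / 2 * (1 / 2) ^ Suc n" for n
  have d: "d n > 0" for n using \<open>e > 0\<close> by (simp add: d_def)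
  have inner: "\<exists>A. compact A \<and> A \<subseteq> Y \<and> emeasure \<nu> (Y - A) < ennreal (d n)" if "Y \<in> sets \<nu>" "Y \<subseteq> K" for Y n
    by (rule regular_borel_inner_compact[OF \<nu> that(1) finP[OF that(2)] d[of n]]) blast
  have "\<exists>A. compact A \<and> A \<subseteq> P n \<and> emeasure \<nu> (P n - A) < ennreal (d n)"
      "\<exists>A. compact A \<and> A \<subseteq> K - P n \<and> emeasure \<nu> (K - P n - A) < ennreal (d n)" for n
    using inner[OF P(1)[of n]] inner[OF P(2)[of n]] by (auto simp: P_def)
  then obtain A A' where A: "\<And>n. compact (A n)" "\<And>n. A n \<subseteq> P n" "\<And>n. emeasure \<nu> (P n - A n) < ennreal (d n)"
    and A': "\<And>n. compact (A' n)" "\<And>n. A' n \<subseteq> K - P n" "\<And>n. emeasure \<nu> (K - P n - A' n) < ennreal (d n)"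
    by metis
  have As: "A n \<in> sets \<nu>" "A' n \<in> sets \<nu>" for n
    using A(1,2)[of n] A'(1,2)[of n] K(2) by (auto intro!: regular_borel_sets[OF \<nu>] borel_compact simp: P_def)
  define T where "T = K \<inter> (\<Inter>n. A n \<union> A' n)"
  have "compact T" unfolding T_def
    using K(1) A(1) A'(1) by (intro compact_Int_closed closed_INT ballI compact_imp_closed compact_Un)
  moreover have "continuous_on T \<psi>"
    unfolding continuous_on_open_invariant
  proof (intro allI impI)
    fix W :: "complex set" assume "open W"
    then obtain B' where B': "B' \<subseteq> B" "W = \<Union>B'" using B(2) topological_basis by metis
    define G where "G = (\<Union>n\<in>{n. V n \<in> B'}. - A' n)"
    have "open G" unfolding G_def using A'(1) by (intro open_UN ballI open_Compl compact_imp_closed)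
    moreover have "G \<inter> T = \<psi> -` W \<inter> T"
    proof -
      have mem: "x \<notin> A' n \<longleftrightarrow> \<psi> x \<in> V n" if "x \<in> T" for x n
        using that A(2)[of n] A'(2)[of n] by (auto simp: T_def P_def)
      have "W = (\<Union>n\<in>{n. V n \<in> B'}. V n)" using B' rV by blast
      then show ?thesis using mem unfolding G_def by blast
    qed
    ultimately show "\<exists>A. open A \<and> A \<inter> T = \<psi> -` W \<inter> T" by blast
  qed
  moreover have "emeasure \<nu> (K - T) \<le> ennreal e"
  proof -
    define Z where "Z n = (P n - A n) \<union> (K - P n - A' n)" for n
    have Z: "Z n \<in> sets \<nu>" for n unfolding Z_def using P As Ks by auto
    have "emeasure \<nu> (Z n) \<le> ennreal (e * (1 / 2) ^ Suc n)" for n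
    proof -
      have "emeasure \<nu> (Z n) \<le> emeasure \<nu> (P n - A n) + emeasure \<nu> (K - P n - A' n)"
        unfolding Z_def using P As Ks by (intro emeasure_subadditive) auto
      also have "\<dots> \<le> ennreal (d n) + ennreal (d n)"
        using A(3) A'(3) by (intro add_mono less_imp_le)
      also have "\<dots> = ennreal (e * (1 / 2) ^ Suc n)"
        using d[of n] by (simp add: ennreal_plus[symmetric] d_def del: ennreal_plus)
      finally show ?thesis .
    qed
    then have "(\<Sum>n. emeasure \<nu> (Z n)) \<le> (\<Sum>n. ennreal (e * (1 / 2) ^ Suc n))"
      by (intro suminf_le) auto
    also have "\<dots> = ennreal e"
    proof (rule suminf_ennreal_eq)
      show "(\<lambda>n. e * (1 / 2) ^ Suc n) sums e" using sums_mult[OF power_half_series, of e] by simp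
    qed (use \<open>e > 0\<close> in auto)
    finally have "(\<Sum>n. emeasure \<nu> (Z n)) \<le> ennreal e" .
    moreover have "K - T \<subseteq> (\<Union>n. Z n)" by (auto simp: T_def Z_def)
    then have "emeasure \<nu> (K - T) \<le> emeasure \<nu> (\<Union>n. Z n)" using Z by (intro emeasure_mono) auto
    moreover have "emeasure \<nu> (\<Union>n. Z n) \<le> (\<Sum>n. emeasure \<nu> (Z n))"
      using Z by (intro emeasure_subadditive_countably) auto
    ultimately show ?thesis by (meson order_trans)
  qed
  ultimately show ?thesis by (intro exI[of _ T]) (auto simp: T_def)
qed

lemma Tietze_complex:
  fixes f :: "'a::metric_space \<Rightarrow> complex"
  assumes "closed S" "continuous_on S f"
  shows "\<exists>g. continuous_on UNIV g \<and> (\<forall>x\<in>S. g x = f x)"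
proof -
  have normal: "normal_space (euclidean :: 'a topology)"
    using metrizable_imp_normal_space metrizable_space_euclidean by blast
  have ext: "\<exists>g. continuous_on UNIV g \<and> (\<forall>x\<in>S. g x = h x)" if "continuous_on S h" for h :: "'a \<Rightarrow> real"
  proof -
    have "\<exists>g. continuous_map euclidean euclidean g \<and> (\<forall>x\<in>S. g x = h x)"
      using normal[unfolded normal_space_iff_Tietze] assms(1) that by simp
    then show ?thesis by simp
  qed
  obtain u v where uv: "continuous_on UNIV u" "\<forall>x\<in>S. u x = Re (f x)" "continuous_on UNIV v" "\<forall>x\<in>S. v x = Im (f x)"
    using ext[of "\<lambda>x. Re (f x)"] ext[of "\<lambda>x. Im (f x)"] assms(2) continuous_on_Re continuous_on_Im by blast
  show ?thesis
    using uv by (intro exI[of _ "\<lambda>x. Complex (u x) (v x)"] conjI ballI)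
      (auto simp: complex_eq_iff Complex_eq intro!: continuous_intros)
qed

text \<open>
  Increasing closed sets on which \<open>\<psi>\<close> is continuous, all containing a given one, with a union of full measure.
\<close>

lemma Lusin_sigma_compact:
  fixes \<psi> :: "'a::metric_space \<Rightarrow> complex" and C :: "nat \<Rightarrow> 'a set"
  assumes \<nu>: "regular_borel_measure_on X \<nu>" and \<psi>: "\<psi> \<in> borel_measurable (restrict_space borel X)"
    and "closed X" and C: "\<And>n. compact (C n)" "\<And>n. C n \<subseteq> C (Suc n)" "(\<Union>n. C n) = UNIV"
    and S: "closed S" "S \<subseteq> X" "continuous_on S \<psi>"
  shows "\<exists>B :: nat \<Rightarrow> 'a set. (\<forall>n. closed (B n) \<and> S \<subseteq> B n \<and> B n \<subseteq> X \<and> B n \<subseteq> B (Suc n) \<and> continuous_on (B n) \<psi>) \<and>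
    X - (\<Union>n. B n) \<in> null_sets \<nu>"
proof -
  have CX: "compact (C n \<inter> X)" for n using C(1) \<open>closed X\<close> by (rule compact_Int_closed)
  have "\<exists>T\<subseteq>C n \<inter> X. compact T \<and> continuous_on T \<psi> \<and> emeasure \<nu> (C n \<inter> X - T) \<le> ennreal ((1 / 2) ^ n)" for n
    by (rule Lusin_compact[OF \<nu> \<psi> CX]) auto
  then obtain T where T: "\<And>n. T n \<subseteq> C n \<inter> X" "\<And>n. compact (T n)" "\<And>n. continuous_on (T n) \<psi>"
      "\<And>n. emeasure \<nu> (C n \<inter> X - T n) \<le> ennreal ((1 / 2) ^ n)"
    by metis
  define B where "B n = S \<union> (\<Union>i\<le>n. T i)" for n
  have cl: "closed (\<Union>i\<le>n. T i)" for n using T(2) by (intro closed_UN ballI compact_imp_closed) auto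
  have "continuous_on (\<Union>i\<le>n. T i) \<psi>" for n
  proof (induction n)
    case 0
    then show ?case using T(3) by simp
  next
    case (Suc n)
    have "(\<Union>i\<le>Suc n. T i) = (\<Union>i\<le>n. T i) \<union> T (Suc n)" by (auto simp: atMost_Suc)
    then show ?case using continuous_on_closed_Un[OF cl compact_imp_closed[OF T(2)] Suc T(3)] by simp
  qed
  then have "continuous_on (B n) \<psi>" for n
    unfolding B_def using S cl by (intro continuous_on_closed_Un)
  moreover have "closed (B n)" for n unfolding B_def using S(1) cl by (rule closed_Un)
  moreover have "B n \<subseteq> X" for n using S(2) T(1) by (auto simp: B_def)
  moreover have "B n \<subseteq> B (Suc n)" for n by (auto simp: B_def)
  moreover have "X - (\<Union>n. B n) \<in> null_sets \<nu>"
  proof -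
    have Xs: "Y \<in> sets \<nu>" if "Y \<subseteq> X" "Y \<in> sets borel" for Y
      using that by (intro regular_borel_sets[OF \<nu>])
    have "C n \<inter> X - (\<Union>n. B n) \<in> null_sets \<nu>" for n
    proof (rule null_setsI)
      have "(\<Union>n. B n) \<in> sets borel" using calculation(2) by auto
      then show "C n \<inter> X - (\<Union>n. B n) \<in> sets \<nu>" using CX[of n] by (intro Xs) (auto intro: borel_compact)
      have "emeasure \<nu> (C n \<inter> X - (\<Union>n. B n)) \<le> ennreal ((1 / 2) ^ i)" if "n \<le> i" for i
      proof -
        have "C n \<subseteq> C i" using C(2) that by (rule lift_Suc_mono_le)
        then have "C n \<inter> X - (\<Union>n. B n) \<subseteq> C i \<inter> X - T i" by (auto simp: B_def)
        moreover have "C i \<inter> X - T i \<in> sets \<nu>"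
          using CX[of i] T(2)[of i] by (intro Xs) (auto intro: borel_compact)
        ultimately have "emeasure \<nu> (C n \<inter> X - (\<Union>n. B n)) \<le> emeasure \<nu> (C i \<inter> X - T i)"
          by (rule emeasure_mono)
        then show ?thesis using T(4) by (rule order_trans)
      qed
      then have "\<forall>\<^sub>F i in sequentially. emeasure \<nu> (C n \<inter> X - (\<Union>n. B n)) \<le> ennreal ((1 / 2) ^ i)"
        by (auto simp: eventually_sequentially)
      moreover have "(\<lambda>i. ennreal ((1 / 2) ^ i)) \<longlonglongrightarrow> ennreal 0"
        by (intro tendsto_ennrealI LIMSEQ_realpow_zero) auto
      ultimately have "emeasure \<nu> (C n \<inter> X - (\<Union>n. B n)) \<le> ennreal 0"
        by (intro tendsto_lowerbound[of _ "ennreal 0" sequentially]) auto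
      then show "emeasure \<nu> (C n \<inter> X - (\<Union>n. B n)) = 0" by simp
    qed
    then have "(\<Union>n. C n \<inter> X - (\<Union>n. B n)) \<in> null_sets \<nu>" by (rule null_sets_UN)
    moreover have "(\<Union>n. C n \<inter> X - (\<Union>n. B n)) = X - (\<Union>n. B n)" using C(3) by blast
    ultimately show ?thesis by simp
  qed
  ultimately show ?thesis by (intro exI[of _ B]) (auto simp: B_def)
qed

section \<open>Functions with prescribed boundary behaviour\<close>

lemma compact_uniform_nbhd:
  fixes g :: "'a::metric_space \<Rightarrow> complex"
  assumes "compact C" "continuous_on UNIV g" "e > 0"
  shows "\<exists>\<eta>>0. \<forall>p\<in>C. \<forall>x. dist p x < \<eta> \<longrightarrow> cmod (g x - g p) < e"
proof -
  define \<G> where "\<G> = (\<lambda>q. g -` ball (g q) (e / 2)) ` C"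
  have "C \<subseteq> \<Union>\<G>" using \<open>e > 0\<close> by (auto simp: \<G>_def)
  moreover have "open G" if "G \<in> \<G>" for G
    using that assms(2) by (auto simp: \<G>_def intro!: open_vimage)
  ultimately obtain \<eta> where \<eta>: "\<eta> > 0" "\<And>p. p \<in> C \<Longrightarrow> \<exists>G\<in>\<G>. ball p \<eta> \<subseteq> G"
    using Heine_Borel_lemma[OF assms(1), of \<G>] by metis
  have "cmod (g x - g p) < e" if "p \<in> C" "dist p x < \<eta>" for p x
  proof -
    obtain q where q: "ball p \<eta> \<subseteq> g -` ball (g q) (e / 2)" using \<eta>(2)[OF \<open>p \<in> C\<close>] by (auto simp: \<G>_def)
    have "p \<in> ball p \<eta>" "x \<in> ball p \<eta>" using that \<eta>(1) by auto
    then have "g p \<in> ball (g q) (e / 2)" "g x \<in> ball (g q) (e / 2)" using q by blast+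
    then show ?thesis using dist_triangle_half_r[of "g q" "g x" e "g p"] by (simp add: dist_norm)
  qed
  then show ?thesis using \<eta>(1) by blast
qed

text \<open>
  A common lower bound for all \<open>p \<in> C\<close> and radii \<open>s \<ge> r\<close>: the ball of radius \<open>s\<close> about \<open>p\<close> contains one of finitely
  many balls of radius \<open>3r / 4\<close>, which in turn contains the ball of radius \<open>r / 2\<close> about \<open>p\<close>.
\<close>

lemma compact_lower_bound_ball_measure:
  fixes U C :: "'a::metric_space set"
  assumes "sets \<mu> = sets borel" "open U" "compact C" "r > 0"
  shows "\<exists>m>0. \<forall>p\<in>C. \<forall>s\<ge>r. emeasure \<mu> (ball p (r / 2) \<inter> U) \<noteq> 0 \<longrightarrow> ennreal m \<le> emeasure \<mu> (ball p s \<inter> U)"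
proof -
  have meas: "ball q t \<inter> U \<in> sets \<mu>" for q t using assms(1,2) by auto
  obtain Q where Q: "Q \<subseteq> C" "finite Q" "C \<subseteq> (\<Union>q\<in>Q. ball q (r / 4))"
    using compactE_image[OF assms(3), of C "\<lambda>q. ball q (r / 4)"] \<open>r > 0\<close> by force
  define t where "t q = emeasure \<mu> (ball q (3 * r / 4) \<inter> U)" for q
  define m where "m = Min (insert 1 (t ` {q \<in> Q. t q \<noteq> 0}))"
  have fin: "finite (insert 1 (t ` {q \<in> Q. t q \<noteq> 0}))" using Q(2) by simp
  have "m > 0" unfolding m_def using fin by (subst Min_gr_iff) (auto simp: zero_less_iff_neq_zero)
  have "m \<le> 1" unfolding m_def using fin by (intro Min_le) auto
  then have mfin: "m < \<infinity>" by (rule le_less_trans) simp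
  have "m \<le> emeasure \<mu> (ball p s \<inter> U)" if "p \<in> C" "s \<ge> r" "emeasure \<mu> (ball p (r / 2) \<inter> U) \<noteq> 0" for p s
  proof -
    obtain q where q: "q \<in> Q" "dist q p < r / 4" using Q(3) \<open>p \<in> C\<close> by auto
    have "ball p (r / 2) \<subseteq> ball q (3 * r / 4)"
    proof
      fix x assume "x \<in> ball p (r / 2)"
      then show "x \<in> ball q (3 * r / 4)" using q(2) dist_triangle[of q x p] by auto
    qed
    then have "emeasure \<mu> (ball p (r / 2) \<inter> U) \<le> t q" unfolding t_def by (intro emeasure_mono meas) auto
    then have "t q \<noteq> 0" using that(3) by auto
    then have "m \<le> t q" unfolding m_def using fin q(1) by (intro Min_le) auto
    also have "ball q (3 * r / 4) \<subseteq> ball p s"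
    proof
      fix x assume "x \<in> ball q (3 * r / 4)"
      then show "x \<in> ball p s" using q(2) that(2) dist_triangle[of p x q] by (auto simp: dist_commute)
    qed
    then have "t q \<le> emeasure \<mu> (ball p s \<inter> U)" unfolding t_def by (intro emeasure_mono meas) auto
    finally show ?thesis .
  qed
  then show ?thesis
    using \<open>m > 0\<close> mfin by (intro exI[of _ "enn2real m"]) (auto simp: enn2real_positive_iff)
qed

lemma eventually_small_remainder:
  fixes U C :: "'a::metric_space set" and H :: "nat \<Rightarrow> 'a set"
  assumes \<mu>: "regular_borel_measure_on UNIV \<mu>" and "open U" "compact C"
    and H: "\<And>n. compact (H n)" "\<And>n. H n \<subseteq> H (Suc n)" "U \<subseteq> (\<Union>n. H n)" and "e > 0"
  shows "\<exists>N. \<forall>n\<ge>N. emeasure \<mu> (C \<inter> U - H n) \<le> ennreal e"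
proof -
  have sets: "sets \<mu> = sets borel" using regular_borel_sets_UNIV[OF \<mu>] .
  have Cs: "C \<in> sets \<mu>" using assms(3) sets by (auto intro: borel_compact)
  have Hs: "H n \<in> sets \<mu>" for n using H(1) sets by (auto intro: borel_compact)
  have fin: "emeasure \<mu> C < \<infinity>" using \<mu> assms(3) by (auto simp: regular_borel_measure_on_def)
  define A where "A n = C \<inter> U - H n" for n
  have As: "A n \<in> sets \<mu>" for n unfolding A_def using Cs Hs assms(2) sets by auto
  have "emeasure \<mu> (A n) \<noteq> \<infinity>" for n
    using emeasure_mono[of "A n" C \<mu>] Cs fin by (force simp: A_def top_unique)
  moreover have "decseq A"
    unfolding decseq_Suc_iff A_def using H(2) by blast
  ultimately have "(\<lambda>n. emeasure \<mu> (A n)) \<longlonglongrightarrow> emeasure \<mu> (\<Inter>n. A n)"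
    using As by (intro Lim_emeasure_decseq) auto
  moreover have "(\<Inter>n. A n) = {}" using H(3) by (auto simp: A_def)
  ultimately have "(\<lambda>n. emeasure \<mu> (A n)) \<longlonglongrightarrow> 0" by simp
  then have "\<forall>\<^sub>F n in sequentially. emeasure \<mu> (A n) < ennreal e"
    using \<open>e > 0\<close> by (intro order_tendstoD) auto
  then show ?thesis unfolding A_def eventually_sequentially by (meson less_imp_le)
qed

lemma limit_of_geometric_steps:
  fixes s :: "nat \<Rightarrow> 'a \<Rightarrow> complex"
  assumes "\<And>n x. x \<in> X \<Longrightarrow> n \<ge> j \<Longrightarrow> cmod (s (Suc n) x - s n x) \<le> (1 / 2) ^ n"
    and "x \<in> X" "m \<ge> j"
  shows "convergent (\<lambda>n. s n x)" "cmod (s m x - lim (\<lambda>n. s n x)) \<le> 2 * (1 / 2) ^ m"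
proof -
  have step: "cmod (s n x - s k x) \<le> 2 * (1 / 2) ^ k - 2 * (1 / 2) ^ n" if "n \<ge> k" "k \<ge> j" for n k
    using that(1)
  proof (induction n rule: dec_induct)
    case base
    then show ?case by simp
  next
    case (step n)
    have "cmod (s (Suc n) x - s k x) \<le> cmod (s (Suc n) x - s n x) + cmod (s n x - s k x)"
      using norm_triangle_ineq[of "s (Suc n) x - s n x" "s n x - s k x"] by simp
    also have "\<dots> \<le> (1 / 2) ^ n + (2 * (1 / 2) ^ k - 2 * (1 / 2) ^ n)"
      using assms(1)[OF assms(2), of n] step that(2) by (intro add_mono) auto
    finally show ?case by simp
  qed
  have bound: "cmod (s n x - s k x) \<le> 2 * (1 / 2) ^ k" if "n \<ge> k" "k \<ge> j" for n k
    using step[OF that] zero_le_power[of "1 / 2 :: real" n] by linarith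
  have "Cauchy (\<lambda>n. s n x)"
  proof (rule CauchyI')
    fix e :: real assume "e > 0"
    then obtain k where k: "(1 / 2) ^ k < e / 2" using real_arch_pow_inv[of "e / 2" "1 / 2"] by auto
    have "dist (s m x) (s n x) < e" if "m \<ge> max j k" "n > m" for m n
    proof -
      have "(1 / 2 :: real) ^ m \<le> (1 / 2) ^ k" using that by (intro power_decreasing) auto
      moreover have "cmod (s n x - s m x) \<le> 2 * (1 / 2) ^ m" using that by (intro bound) auto
      ultimately have "cmod (s n x - s m x) < e" using k by linarith
      then show ?thesis by (simp add: dist_norm norm_minus_commute)
    qed
    then show "\<exists>M. \<forall>m\<ge>M. \<forall>n>m. dist (s m x) (s n x) < e" by blast
  qed
  then show conv: "convergent (\<lambda>n. s n x)" by (simp add: Cauchy_convergent_iff)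
  show "cmod (s m x - lim (\<lambda>n. s n x)) \<le> 2 * (1 / 2) ^ m"
  proof (rule tendsto_upperbound)
    show "(\<lambda>n. cmod (s m x - s n x)) \<longlonglongrightarrow> cmod (s m x - lim (\<lambda>n. s n x))"
      using conv by (intro tendsto_intros) (simp add: convergent_LIMSEQ_iff)
    show "\<forall>\<^sub>F n in sequentially. cmod (s m x - s n x) \<le> 2 * (1 / 2) ^ m"
      using bound[OF _ assms(3)] by (auto simp: eventually_sequentially norm_minus_commute)
  qed auto
qed

context function_algebra
begin

text \<open>
  Members \<open>s n\<close> of the algebra are built by recursion on an exhaustion \<open>K n\<close>: the step from \<open>s j\<close> to
  \<open>s (Suc j)\<close> is less than \<open>2\<^sup>-\<^sup>j\<close> on \<open>K j\<close>, and brings the function within \<open>2\<^sup>-\<^sup>j\<close> of \<open>\<Psi> j\<close> on a compact subset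
  \<open>E j\<close> of the shell \<open>K (Suc j) - K j\<close>.  The approach set of a boundary point \<open>p\<close> consists of those points of
  the sets \<open>E j\<close>, for large \<open>j\<close>, that are closer to \<open>p\<close> than a modulus of continuity \<open>\<eta> j\<close> of \<open>\<Psi> j\<close>.

  The two kinds of omitted points have small measure for different reasons.  Points of shell \<open>j\<close> at
  distance at least \<open>\<eta> j\<close> from \<open>p\<close> only matter in balls of radius greater than \<open>\<eta> j\<close>, and \<open>K j\<close> is taken so
  large that what lies beyond it is negligible against all these balls.  Points of shell \<open>j\<close> outside \<open>E j\<close>
  only matter in balls of radius greater than the distance \<open>\<delta> j\<close> of \<open>K (Suc j)\<close> to the boundary, and \<open>E j\<close>
  is chosen after \<open>\<delta> j\<close>.  If \<open>\<mu> (ball p r \<inter> U) = 0\<close> for some \<open>r\<close>, the empty approach set will do.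
\<close>

theorem exists_function_with_boundary_values:
  fixes C H B :: "nat \<Rightarrow> 'a set" and \<mu> :: "'a measure" and \<psi> :: "'a \<Rightarrow> complex" and \<Psi> :: "nat \<Rightarrow> 'a \<Rightarrow> complex"
  assumes sep: "\<forall>x\<in>U. \<forall>y\<in>U. x \<noteq> y \<longrightarrow> (\<exists>f\<in>\<O>. f x \<noteq> f y)"
    and "open U"
    and C: "\<And>n. compact (C n)" "\<And>n. C n \<subseteq> interior (C (Suc n))" "(\<Union>n. C n) = UNIV"
    and H: "\<And>n. compact (H n)" "\<And>n. H n \<subseteq> H (Suc n)" "\<And>n. H n \<subseteq> U"
    and H_convex: "\<And>n. \<forall>x\<in>U - H n. \<exists>f\<in>\<O>. \<exists>b. (\<forall>y\<in>H n. cmod (f y) \<le> b) \<and> b < cmod (f x)"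
    and H_exhausts': "\<forall>K. compact K \<longrightarrow> K \<subseteq> U \<longrightarrow> (\<exists>n. K \<subseteq> H n)"
    and \<mu>: "regular_borel_measure_on UNIV \<mu>"
    and B: "\<And>n. B n \<subseteq> B (Suc n)" "\<And>n. B n \<subseteq> frontier U"
    and \<Psi>_cont: "\<And>n. continuous_on UNIV (\<Psi> n)" and \<Psi>_eq: "\<And>n. \<forall>x\<in>B n. \<Psi> n x = \<psi> x"
  shows "\<exists>s f. (\<forall>n. s n \<in> \<O>) \<and> (\<forall>K. compact K \<longrightarrow> K \<subseteq> U \<longrightarrow> uniform_limit K s f sequentially) \<and>
    (\<forall>p\<in>\<Union>n. B n. \<exists>Fp. Fp \<subseteq> U \<and> Fp \<in> sets \<mu> \<and>
         (f \<longlongrightarrow> \<psi> p) (at p within Fp) \<and>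
         (\<forall>\<epsilon>>0. \<exists>r0>0. \<forall>r. 0 < r \<and> r < r0 \<longrightarrow>
            emeasure \<mu> (ball p r \<inter> (U - Fp)) \<le> ennreal \<epsilon> * emeasure \<mu> (ball p r \<inter> U)))"
proof -
  have sets: "sets \<mu> = sets borel" using regular_borel_sets_UNIV[OF \<mu>] .
  have compact_sets: "K \<in> sets \<mu>" if "compact K" for K using sets that by (auto intro: borel_compact)
  have open_sets: "G \<in> sets \<mu>" if "open G" for G using sets that by auto
  note H_exhausts = H_exhausts'[rule_format]
  note \<Psi> = \<Psi>_cont \<Psi>_eq[rule_format]
  define T where "T p r = emeasure \<mu> (ball p r \<inter> U)" for p r
  have C_mono: "C m \<subseteq> C n" if "m \<le> n" for m n
    using subset_trans[OF C(2) interior_subset] that by (rule lift_Suc_mono_le)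
  have H_mono: "H m \<subseteq> H n" if "m \<le> n" for m n
    using H(2) that by (rule lift_Suc_mono_le)
  have B_mono: "B m \<subseteq> B n" if "m \<le> n" for m n
    using B(1) that by (rule lift_Suc_mono_le)

  have "\<exists>\<eta>>0. \<forall>p\<in>C j. \<forall>x. dist p x < \<eta> \<longrightarrow> cmod (\<Psi> j x - \<Psi> j p) < (1 / 2) ^ j" for j
    using C(1) \<Psi>(1) by (rule compact_uniform_nbhd) simp
  then obtain \<eta> where \<eta>: "\<And>j. \<eta> j > 0"
      "\<And>j p x. p \<in> C j \<Longrightarrow> dist p x < \<eta> j \<Longrightarrow> cmod (\<Psi> j x - \<Psi> j p) < (1 / 2) ^ j"
    by metis
  have mass: "\<exists>m>0. \<forall>p\<in>C j. \<forall>s\<ge>r. T p (r / 2) \<noteq> 0 \<longrightarrow> ennreal m \<le> T p s" if "r > 0" for j r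
    unfolding T_def using sets \<open>open U\<close> C(1) that by (rule compact_lower_bound_ball_measure)
  have "\<forall>j. \<exists>m. m > 0 \<and> (\<forall>p\<in>C j. \<forall>s\<ge>\<eta> j. T p (\<eta> j / 2) \<noteq> 0 \<longrightarrow> ennreal m \<le> T p s)"
    using mass[OF \<eta>(1)] by blast
  from choice[OF this] obtain m where m: "\<And>j. m j > 0"
      "\<And>j p s. p \<in> C j \<Longrightarrow> \<eta> j \<le> s \<Longrightarrow> T p (\<eta> j / 2) \<noteq> 0 \<Longrightarrow> ennreal (m j) \<le> T p s"
    by blast

  have U_H: "U \<subseteq> (\<Union>n. H n)"
  proof
    fix x assume "x \<in> U"
    then show "x \<in> (\<Union>n. H n)" using H_exhausts[of "{x}"] by auto
  qed
  \<comment> \<open>The choice of the exhaustion; \<open>m j\<close> is the lower bound for balls of radius at least \<open>\<eta> j\<close>.\<close>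
  have "\<exists>N. \<forall>n\<ge>N. emeasure \<mu> (C (Suc j) \<inter> U - H n) \<le> ennreal (m j * (1 / 2) ^ j)" for j
    using m(1) by (intro eventually_small_remainder \<mu> \<open>open U\<close> C(1) H(1,2) U_H) auto
  then obtain N0 where N0: "\<And>j n. n \<ge> N0 j \<Longrightarrow> emeasure \<mu> (C (Suc j) \<inter> U - H n) \<le> ennreal (m j * (1 / 2) ^ j)"
    by metis
  define k where "k j = j + (\<Sum>i\<le>j. N0 i)" for j
  define K where "K j = H (k j)" for j
  have K: "compact (K j)" "K j \<subseteq> U" for j using H by (auto simp: K_def)
  have K_Suc: "K j \<subseteq> K (Suc j)" for j unfolding K_def by (intro H_mono) (simp add: k_def)
  have K_mono: "K i \<subseteq> K j" if "i \<le> j" for i j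
    using K_Suc that by (rule lift_Suc_mono_le)
  have K_exhausts: "\<exists>j. L \<subseteq> K j" if L: "compact L" "L \<subseteq> U" for L
  proof -
    obtain n where "L \<subseteq> H n" using H_exhausts[OF L] by blast
    also have "H n \<subseteq> K n" unfolding K_def by (intro H_mono) (simp add: k_def)
    finally show ?thesis by blast
  qed
  have K_remainder: "emeasure \<mu> (C (Suc j) \<inter> U - K j) \<le> ennreal (m j * (1 / 2) ^ j)" for j
  proof -
    have "N0 j \<le> (\<Sum>i\<le>j. N0 i)" by (intro member_le_sum) auto
    then show ?thesis unfolding K_def by (intro N0) (simp add: k_def)
  qed

  have disj: "K j \<inter> frontier U = {}" for j
    using K(2)[of j] \<open>open U\<close> by (auto simp: frontier_def interior_open)
  have "\<exists>\<delta>>0. \<forall>x\<in>K (Suc j). \<forall>p\<in>frontier U. \<delta> \<le> dist x p" for j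
  proof -
    have "K (Suc j) \<subseteq> \<Union>{- frontier U}" using disj by auto
    moreover have "open G" if "G \<in> {- frontier U}" for G using that by auto
    ultimately obtain \<delta> where "\<delta> > 0" and \<delta>: "\<And>x. x \<in> K (Suc j) \<Longrightarrow> \<exists>G\<in>{- frontier U}. ball x \<delta> \<subseteq> G"
      using Heine_Borel_lemma[OF K(1)[of "Suc j"], of "{- frontier U}"] by metis
    have "\<delta> \<le> dist x p" if "x \<in> K (Suc j)" "p \<in> frontier U" for x p
    proof -
      have "ball x \<delta> \<subseteq> - frontier U" using \<delta>[OF that(1)] by simp
      then have "p \<notin> ball x \<delta>" using that(2) by blast
      then show ?thesis by simp
    qed
    then show ?thesis using \<open>\<delta> > 0\<close> by blast
  qed
  then obtain \<delta> where \<delta>: "\<And>j. \<delta> j > 0" "\<And>j x p. x \<in> K (Suc j) \<Longrightarrow> p \<in> frontier U \<Longrightarrow> \<delta> j \<le> dist x p"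
    by metis
  have "\<forall>j. \<exists>m. m > 0 \<and> (\<forall>p\<in>C j. \<forall>s\<ge>\<delta> j. T p (\<delta> j / 2) \<noteq> 0 \<longrightarrow> ennreal m \<le> T p s)"
    using mass[OF \<delta>(1)] by blast
  from choice[OF this] obtain \<kappa> where \<kappa>: "\<And>j. \<kappa> j > 0"
      "\<And>j p s. p \<in> C j \<Longrightarrow> \<delta> j \<le> s \<Longrightarrow> T p (\<delta> j / 2) \<noteq> 0 \<Longrightarrow> ennreal (\<kappa> j) \<le> T p s"
    by blast

  \<comment> \<open>The correction \<open>g\<close> to be added to \<open>s\<close> at stage \<open>j\<close>; \<open>\<kappa> j\<close> plays the part of \<open>m j\<close> for the radii \<open>\<delta> j\<close>.\<close>
  define good where "good j s g E \<longleftrightarrow> g \<in> \<O> \<and> E \<subseteq> K (Suc j) - K j \<and> compact E \<and>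
      emeasure \<mu> (K (Suc j) - K j - E) \<le> ennreal (\<kappa> j * (1 / 2) ^ j) \<and>
      (\<forall>x\<in>K j. cmod (g x) < (1 / 2) ^ j) \<and> (\<forall>x\<in>E. cmod (g x - (\<Psi> j x - s x)) < (1 / 2) ^ j)" for j s g E
  have "\<exists>g E. good j s g E" if "s \<in> \<O>" for j s
  proof -
    have "continuous_on (K (Suc j)) (\<lambda>x. \<Psi> j x - s x)"
      using continuous_on_mem[OF that] \<Psi>(1) K(2) by (intro continuous_intros) (auto intro: continuous_on_subset)
    moreover have "\<forall>x\<in>U - K j. \<exists>f\<in>\<O>. \<exists>b. (\<forall>y\<in>K j. cmod (f y) \<le> b) \<and> b < cmod (f x)"
      unfolding K_def by (rule H_convex)
    moreover have "\<kappa> j * (1 / 2) ^ j > 0" "(1 / 2 :: real) ^ j > 0" using \<kappa>(1) by auto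
    ultimately show ?thesis
      using approximate_extending_zero[OF sep K(1) K(2) _ K(1) K(2) \<mu>] unfolding good_def by blast
  qed
  then have "\<forall>j s. \<exists>z. s \<in> \<O> \<longrightarrow> good j s (fst z) (snd z)" by fastforce
  then obtain Z where Z: "\<And>j s. s \<in> \<O> \<Longrightarrow> good j s (fst (Z j s)) (snd (Z j s))" by metis
  define G where "G j s = fst (Z j s)" for j s
  define E' where "E' j s = snd (Z j s)" for j s
  have good: "good j s (G j s) (E' j s)" if "s \<in> \<O>" for j s
    unfolding G_def E'_def using that by (rule Z)
  define s where "s = rec_nat (\<lambda>_. 0) (\<lambda>j s x. s x + G j s x)"
  have s_simps: "s 0 = (\<lambda>_. 0)" "s (Suc j) = (\<lambda>x. s j x + G j (s j) x)" for j
    by (simp_all add: s_def)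
  have s_mem: "s j \<in> \<O>" for j
  proof (induction j)
    case 0
    then show ?case by (simp add: s_simps const_mem)
  next
    case (Suc j)
    then show ?case using good[OF Suc] by (auto simp: s_simps good_def intro: add_mem)
  qed
  define E where "E j = E' j (s j)" for j
  have E: "E j \<subseteq> K (Suc j) - K j" "compact (E j)"
      "emeasure \<mu> (K (Suc j) - K j - E j) \<le> ennreal (\<kappa> j * (1 / 2) ^ j)" for j
    using good[OF s_mem] unfolding good_def E_def by blast+
  have s_K: "cmod (s (Suc j) x - s j x) < (1 / 2) ^ j" if "x \<in> K j" for j x
    using good[OF s_mem, of j j] that by (auto simp: good_def s_simps)
  have s_E: "cmod (s (Suc j) x - \<Psi> j x) < (1 / 2) ^ j" if "x \<in> E j" for j x
    using good[OF s_mem, of j j] that by (auto simp: good_def s_simps E_def algebra_simps)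

  define f where "f x = lim (\<lambda>n. s n x)" for x
  have s_f: "cmod (s n x - f x) \<le> 2 * (1 / 2) ^ n" if "x \<in> K j" "n \<ge> j" for n j x
    unfolding f_def
  proof (rule limit_of_geometric_steps(2)[of "K j" j s])
    show "cmod (s (Suc i) y - s i y) \<le> (1 / 2) ^ i" if "y \<in> K j" "i \<ge> j" for i y
      using s_K[of y i] K_mono[OF that(2)] that(1) by force
  qed (use that in auto)
  have f_E: "cmod (f x - \<Psi> j x) \<le> 2 * (1 / 2) ^ j" if "x \<in> E j" for j x
  proof -
    have "cmod (s (Suc j) x - f x) \<le> 2 * (1 / 2) ^ Suc j"
      using E(1)[of j] that by (intro s_f[of x "Suc j"]) auto
    then show ?thesis
      using s_E[OF that] norm_triangle_ineq[of "f x - s (Suc j) x" "s (Suc j) x - \<Psi> j x"]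
      by (simp add: norm_minus_commute)
  qed

  have unif: "uniform_limit L s f sequentially" if L: "compact L" "L \<subseteq> U" for L
    unfolding uniform_limit_iff
  proof (intro allI impI)
    fix e :: real assume "e > 0"
    obtain j where j: "L \<subseteq> K j" using K_exhausts[OF L] by blast
    obtain n0 where n0: "(1 / 2) ^ n0 < e / 2" using real_arch_pow_inv[of "e / 2" "1 / 2"] \<open>e > 0\<close> by auto
    have "dist (s n x) (f x) < e" if "n \<ge> max j n0" "x \<in> L" for n x
    proof -
      have "(1 / 2 :: real) ^ n \<le> (1 / 2) ^ n0" using that by (intro power_decreasing) auto
      moreover have "cmod (s n x - f x) \<le> 2 * (1 / 2) ^ n" using j that by (intro s_f[of x j]) auto
      ultimately have "cmod (s n x - f x) < e" using n0 by linarith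
      then show ?thesis by (simp add: dist_norm)
    qed
    then show "\<forall>\<^sub>F n in sequentially. \<forall>x\<in>L. dist (s n x) (f x) < e"
      unfolding eventually_sequentially by blast
  qed

  have boundary: "\<exists>Fp. Fp \<subseteq> U \<and> Fp \<in> sets \<mu> \<and> (f \<longlongrightarrow> \<psi> p) (at p within Fp) \<and>
         (\<forall>\<epsilon>>0. \<exists>r0>0. \<forall>r. 0 < r \<and> r < r0 \<longrightarrow>
            emeasure \<mu> (ball p r \<inter> (U - Fp)) \<le> ennreal \<epsilon> * T p r)"
    if p: "p \<in> B i0" for p i0
  proof (cases "\<exists>r>0. T p r = 0")
    case True
    then obtain r0 where r0: "r0 > 0" "T p r0 = 0" by blast
    have "T p r \<le> T p r0" if "r < r0" for r
      unfolding T_def using that \<open>open U\<close> by (intro emeasure_mono open_sets) auto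
    then have "emeasure \<mu> (ball p r \<inter> U) = 0" if "r < r0" for r
      using r0(2) that by (fastforce simp: T_def)
    then show ?thesis using r0(1) by (intro exI[of _ "{}"]) auto
  next
    case False
    then have T_pos: "T p r \<noteq> 0" if "r > 0" for r using that by blast
    obtain i1 where i1: "p \<in> C i1" using C(3) by blast
    define i where "i = max i0 i1"
    have pC: "p \<in> C j" and pB: "p \<in> B j" if "j \<ge> i" for j
      using C_mono[of i1 j] B_mono[of i0 j] i1 p that by (auto simp: i_def)
    have pU: "p \<in> frontier U" using p B(2) by blast
    define Fp where "Fp = (\<Union>j\<in>{i..}. E j \<inter> ball p (\<eta> j))"
    have "Fp \<subseteq> U" using E(1) K(2) unfolding Fp_def by blast
    moreover have "Fp \<in> sets \<mu>" unfolding Fp_def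
      by (rule sets.countable_UN'') (use compact_sets[OF E(2)] open_sets[OF open_ball] in auto)
    moreover have "(f \<longlongrightarrow> \<psi> p) (at p within Fp)"
      unfolding tendsto_iff
    proof (intro allI impI)
      fix e :: real assume "e > 0"
      obtain n where n: "(1 / 2) ^ n < e / 3" using real_arch_pow_inv[of "e / 3" "1 / 2"] \<open>e > 0\<close> by auto
      have "dist (f x) (\<psi> p) < e" if "x \<in> Fp" "dist x p < \<delta> n" for x
      proof -
        obtain j where j: "j \<ge> i" "x \<in> E j" "dist p x < \<eta> j" using \<open>x \<in> Fp\<close> by (auto simp: Fp_def)
        have "j \<ge> n"
        proof (rule ccontr)
          assume "\<not> j \<ge> n"
          then have "x \<in> K (Suc n)" using E(1)[of j] j(2) K_mono[of "Suc j" "Suc n"] by auto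
          then show False using \<delta>(2)[OF _ pU, of x n] that(2) by simp
        qed
        then have "(1 / 2 :: real) ^ j \<le> (1 / 2) ^ n" by (intro power_decreasing) auto
        moreover have "cmod (f x - \<Psi> j x) \<le> 2 * (1 / 2) ^ j" using f_E[OF j(2)] .
        moreover have "cmod (\<Psi> j x - \<psi> p) < (1 / 2) ^ j"
          using \<eta>(2)[OF pC[OF j(1)] j(3)] \<Psi>(2)[OF pB[OF j(1)]] by simp
        moreover have "cmod (f x - \<psi> p) \<le> cmod (f x - \<Psi> j x) + cmod (\<Psi> j x - \<psi> p)"
          using norm_triangle_ineq[of "f x - \<Psi> j x" "\<Psi> j x - \<psi> p"] by simp
        ultimately have "cmod (f x - \<psi> p) < e" using n by linarith
        then show ?thesis by (simp add: dist_norm)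
      qed
      then show "\<forall>\<^sub>F x in at p within Fp. dist (f x) (\<psi> p) < e"
        unfolding eventually_at using \<delta>(1)[of n] by blast
    qed
    moreover have "\<exists>r0>0. \<forall>r. 0 < r \<and> r < r0 \<longrightarrow> emeasure \<mu> (ball p r \<inter> (U - Fp)) \<le> ennreal \<epsilon> * T p r"
      if "\<epsilon> > 0" for \<epsilon> :: real
    proof -
      obtain J0 where J0: "(1 / 2) ^ J0 < \<epsilon> / 4" using real_arch_pow_inv[of "\<epsilon> / 4" "1 / 2"] \<open>\<epsilon> > 0\<close> by auto
      define J where "J = max i J0"
      have "(1 / 2 :: real) ^ J \<le> (1 / 2) ^ J0" by (intro power_decreasing) (auto simp: J_def)
      then have J: "4 * (1 / 2) ^ J \<le> \<epsilon>" using J0 by linarith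
      have iJ: "i \<le> J" by (simp add: J_def)
      obtain rC where rC: "rC > 0" "ball p rC \<subseteq> C (Suc i)"
        using C(2)[of i] pC[of i] by (meson in_mono mem_interior order_refl)
      have "emeasure \<mu> (ball p r \<inter> (U - Fp)) \<le> ennreal \<epsilon> * T p r" if r: "0 < r" "r < min rC (\<delta> J)" for r
      proof -
        \<comment> \<open>The omitted points of shell \<open>j\<close>; those in \<open>K (Suc J)\<close> are too far from \<open>p\<close> to matter.\<close>
        define Bad where "Bad j = (K (Suc j) - K j - E j) \<union> (K (Suc j) - K j - ball p (\<eta> j))" for j
        have meas: "ball p r \<inter> (K (Suc j) - K j - E j) \<in> sets \<mu>"
          "ball p r \<inter> (K (Suc j) - K j - ball p (\<eta> j)) \<in> sets \<mu>" "C (Suc j) \<inter> U - K j \<in> sets \<mu>"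
          "K (Suc j) - K j - E j \<in> sets \<mu>" for j
          using compact_sets[OF K(1)] compact_sets[OF E(2)] compact_sets[OF C(1)] open_sets \<open>open U\<close> by auto
        have "ball p r \<inter> (U - Fp) \<subseteq> (\<Union>n. ball p r \<inter> Bad (J + n))"
        proof
          fix x assume x: "x \<in> ball p r \<inter> (U - Fp)"
          then obtain j0 where j0: "x \<in> K j0" using K_exhausts[of "{x}"] by auto
          define l where "l = (LEAST j. x \<in> K j)"
          have l: "x \<in> K l" "\<And>j. j < l \<Longrightarrow> x \<notin> K j"
            unfolding l_def using j0 by (auto intro: LeastI dest: not_less_Least)
          have "l > Suc J"
          proof (rule ccontr)
            assume "\<not> l > Suc J"
            then have "x \<in> K (Suc J)" using l(1) K_mono[of l "Suc J"] by auto
            then show False using \<delta>(2)[OF _ pU, of x J] x r(2) by (simp add: dist_commute)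
          qed
          then obtain j where j: "l = Suc j" "j \<ge> J" by (cases l) auto
          then have "x \<in> K (Suc j) - K j" using l by auto
          moreover have "x \<notin> E j \<inter> ball p (\<eta> j)" using x j(2) iJ by (auto simp: Fp_def)
          ultimately have "x \<in> Bad j" by (auto simp: Bad_def)
          then show "x \<in> (\<Union>n. ball p r \<inter> Bad (J + n))"
            using x j(2) by (intro UN_I[of "j - J"]) auto
        qed
        then have "emeasure \<mu> (ball p r \<inter> (U - Fp)) \<le> emeasure \<mu> (\<Union>n. ball p r \<inter> Bad (J + n))"
          using meas by (intro emeasure_mono) (auto simp: Bad_def Int_Un_distrib)
        also have "\<dots> \<le> (\<Sum>n. emeasure \<mu> (ball p r \<inter> Bad (J + n)))"
          using meas by (intro emeasure_subadditive_countably) (auto simp: Bad_def Int_Un_distrib)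
        also have "\<dots> \<le> (\<Sum>n. ennreal (2 * (1 / 2) ^ J * (1 / 2) ^ n) * T p r)"
        proof (intro suminf_le allI)
          fix n
          define j where "j = J + n"
          have pCj: "p \<in> C j" using pC[of j] iJ by (simp add: j_def)
          have "emeasure \<mu> (ball p r \<inter> (K (Suc j) - K j - E j)) \<le> ennreal ((1 / 2) ^ j) * T p r"
          proof (cases "ball p r \<inter> (K (Suc j) - K j - E j) = {}")
            case False
            then obtain x where "x \<in> K (Suc j)" "dist p x < r" by auto
            then have "\<delta> j \<le> r" using \<delta>(2)[OF _ pU, of x j] by (simp add: dist_commute)
            have "emeasure \<mu> (ball p r \<inter> (K (Suc j) - K j - E j)) \<le> emeasure \<mu> (K (Suc j) - K j - E j)"
              using meas by (intro emeasure_mono) auto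
            also have "\<dots> \<le> ennreal (\<kappa> j * (1 / 2) ^ j)" by (rule E(3))
            also have "\<dots> = ennreal ((1 / 2) ^ j) * ennreal (\<kappa> j)"
              by (subst ennreal_mult'[symmetric]) (auto simp: mult.commute)
            also have "\<dots> \<le> ennreal ((1 / 2) ^ j) * T p r"
              using \<delta>(1)[of j] by (intro mult_left_mono \<kappa>(2)[OF pCj \<open>\<delta> j \<le> r\<close>] T_pos) auto
            finally show ?thesis .
          qed simp
          moreover have "emeasure \<mu> (ball p r \<inter> (K (Suc j) - K j - ball p (\<eta> j))) \<le> ennreal ((1 / 2) ^ j) * T p r"
          proof (cases "ball p r \<inter> (K (Suc j) - K j - ball p (\<eta> j)) = {}")
            case False
            then obtain x where "dist p x < r" "\<not> dist p x < \<eta> j" by auto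
            then have "\<eta> j \<le> r" by simp
            have "ball p r \<subseteq> C (Suc j)"
              using rC(2) r(2) C_mono[of "Suc i" "Suc j"] iJ subset_ball[of r rC p] by (auto simp: j_def)
            then have "emeasure \<mu> (ball p r \<inter> (K (Suc j) - K j - ball p (\<eta> j))) \<le> emeasure \<mu> (C (Suc j) \<inter> U - K j)"
              using meas K(2)[of "Suc j"] by (intro emeasure_mono) auto
            also have "\<dots> \<le> ennreal (m j * (1 / 2) ^ j)" by (rule K_remainder)
            also have "\<dots> = ennreal ((1 / 2) ^ j) * ennreal (m j)"
              by (subst ennreal_mult'[symmetric]) (auto simp: mult.commute)
            also have "\<dots> \<le> ennreal ((1 / 2) ^ j) * T p r"
              using \<eta>(1)[of j] by (intro mult_left_mono m(2)[OF pCj \<open>\<eta> j \<le> r\<close>] T_pos) auto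
            finally show ?thesis .
          qed simp
          moreover have "emeasure \<mu> (ball p r \<inter> Bad j) \<le> emeasure \<mu> (ball p r \<inter> (K (Suc j) - K j - E j)) +
              emeasure \<mu> (ball p r \<inter> (K (Suc j) - K j - ball p (\<eta> j)))"
            unfolding Bad_def Int_Un_distrib using meas by (intro emeasure_subadditive) auto
          ultimately have "emeasure \<mu> (ball p r \<inter> Bad j) \<le> ennreal ((1 / 2) ^ j) * T p r + ennreal ((1 / 2) ^ j) * T p r"
            by (meson add_mono order_trans)
          also have "\<dots> = ennreal (2 * (1 / 2) ^ J * (1 / 2) ^ n) * T p r"
            by (simp add: distrib_right[symmetric] ennreal_plus[symmetric] j_def power_add del: ennreal_plus)
          finally show "emeasure \<mu> (ball p r \<inter> Bad (J + n)) \<le> ennreal (2 * (1 / 2) ^ J * (1 / 2) ^ n) * T p r"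
            by (simp add: j_def)
        qed auto
        also have "\<dots> = (\<Sum>n. ennreal (2 * (1 / 2) ^ J * (1 / 2) ^ n)) * T p r" by simp
        also have "(\<Sum>n. ennreal (2 * (1 / 2) ^ J * (1 / 2) ^ n)) = ennreal (2 * (1 / 2) ^ J * 2)"
        proof (rule suminf_ennreal_eq)
          show "(\<lambda>n. 2 * (1 / 2) ^ J * (1 / 2) ^ n) sums (2 * (1 / 2) ^ J * 2 :: real)"
            using sums_mult[OF geometric_sums[of "1 / 2 :: real"], of "2 * (1 / 2) ^ J"] by simp
        qed auto
        also have "ennreal (2 * (1 / 2) ^ J * 2) * T p r \<le> ennreal \<epsilon> * T p r"
          using J by (intro mult_right_mono ennreal_leI) auto
        finally show ?thesis .
      qed
      then show ?thesis using rC(1) \<delta>(1)[of J] by (intro exI[of _ "min rC (\<delta> J)"]) auto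
    qed
    ultimately show ?thesis by blast
  qed
  show ?thesis
  proof (rule exI[of _ s], rule exI[of _ f], intro conjI allI impI ballI)
    show "s n \<in> \<O>" for n by (rule s_mem)
    show "uniform_limit L s f sequentially" if "compact L" "L \<subseteq> U" for L
      using that by (rule unif)
    fix p assume "p \<in> (\<Union>n. B n)"
    then obtain i0 where "p \<in> B i0" by blast
    from boundary[OF this] show "\<exists>Fp. Fp \<subseteq> U \<and> Fp \<in> sets \<mu> \<and> (f \<longlongrightarrow> \<psi> p) (at p within Fp) \<and>
         (\<forall>\<epsilon>>0. \<exists>r0>0. \<forall>r. 0 < r \<and> r < r0 \<longrightarrow>
            emeasure \<mu> (ball p r \<inter> (U - Fp)) \<le> ennreal \<epsilon> * emeasure \<mu> (ball p r \<inter> U))"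
      unfolding T_def .
  qed
qed

end

section \<open>Holomorphic functions on a complex manifold\<close>

lemma is_chart_open_image:
  assumes "is_chart (V, \<phi>)" "open W"
  shows "open (\<phi> ` (V \<inter> W))"
proof -
  have V: "open V" "open (\<phi> ` V)" "homeomorphism V (\<phi> ` V) \<phi> (inv_into V \<phi>)"
    using assms(1) by (auto simp: is_chart_def)
  have "openin (top_of_set V) (V \<inter> W)" using assms(2) by (rule openin_open_Int)
  then have "openin (top_of_set (\<phi> ` V)) (\<phi> ` (V \<inter> W))" by (rule homeomorphism_imp_open_map[OF V(3)])
  then show ?thesis using V(2) openin_open_eq by blast
qed

lemma is_chart_inv:
  assumes "is_chart (V, \<phi>)" "x \<in> V"
  shows "inv_into V \<phi> (\<phi> x) = x"
  using assms by (auto simp: is_chart_def homeomorphism_def)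

lemma complex_atlas_chart_at:
  assumes "complex_atlas A"
  obtains V \<phi> where "(V, \<phi>) \<in> A" "is_chart (V, \<phi>)" "x \<in> V"
proof -
  have "x \<in> (\<Union>c\<in>A. fst c)" using assms by (simp add: complex_atlas_def)
  then obtain c where "c \<in> A" "x \<in> fst c" by blast
  then show thesis using assms that[of "fst c" "snd c"] by (simp add: complex_atlas_def)
qed

lemma complex_atlas_locally_compact:
  fixes A :: "('a::metric_space, 'n::finite) chart set"
  assumes "complex_atlas A"
  shows "\<exists>r>0. compact (cball (x::'a) r)"
proof -
  obtain V \<phi> where c: "(V, \<phi>) \<in> A" "is_chart (V, \<phi>)" "x \<in> V"
    using complex_atlas_chart_at[OF assms] .
  have V: "open V" "open (\<phi> ` V)" "homeomorphism V (\<phi> ` V) \<phi> (inv_into V \<phi>)"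
    using c(2) by (auto simp: is_chart_def)
  obtain s where s: "s > 0" "cball (\<phi> x) s \<subseteq> \<phi> ` V"
    using V(2) c(3) open_contains_cball by blast
  define L where "L = inv_into V \<phi> ` cball (\<phi> x) s"
  have "compact L"
    unfolding L_def using V(3) s(2)
    by (intro compact_continuous_image compact_cball) (auto simp: homeomorphism_def intro: continuous_on_subset)
  have "open (V \<inter> \<phi> -` ball (\<phi> x) s)"
    using V(1,3) by (intro continuous_open_preimage) (auto simp: homeomorphism_def)
  moreover have "x \<in> V \<inter> \<phi> -` ball (\<phi> x) s" using c(3) s(1) by auto
  ultimately obtain r where r: "r > 0" "cball x r \<subseteq> V \<inter> \<phi> -` ball (\<phi> x) s"
    using open_contains_cball by blast
  have "cball x r \<subseteq> L"
  proof
    fix y assume "y \<in> cball x r"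
    then have "y \<in> V" "\<phi> y \<in> cball (\<phi> x) s" using r(2) by auto
    then show "y \<in> L" unfolding L_def using is_chart_inv[OF c(2) \<open>y \<in> V\<close>] by (intro image_eqI[of _ _ "\<phi> y"]) auto
  qed
  then have "L \<inter> cball x r = cball x r" by blast
  moreover have "compact (L \<inter> cball x r)" using \<open>compact L\<close> by (intro compact_Int_closed) auto
  ultimately show ?thesis using r(1) by auto
qed

lemma holomorphic_fun_on_continuous:
  assumes A: "complex_atlas A" and "open U" and f: "holomorphic_fun_on A f U"
  shows "continuous_on U f"
proof (intro continuous_at_imp_continuous_on ballI)
  fix x assume "x \<in> U"
  obtain V \<phi> where c: "(V, \<phi>) \<in> A" "is_chart (V, \<phi>)" "x \<in> V"
    using complex_atlas_chart_at[OF A] .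
  have V: "open V" "continuous_on V \<phi>"
    using c(2) by (auto simp: is_chart_def homeomorphism_def)
  have "holomorphic_Cn_on (\<lambda>z. f (inv_into V \<phi> z)) (\<phi> ` (V \<inter> U))"
    using f c(1) by (auto simp: holomorphic_fun_on_def)
  then obtain D where "((\<lambda>z. f (inv_into V \<phi> z)) has_derivative D) (at (\<phi> x))"
    using c(3) \<open>x \<in> U\<close> unfolding holomorphic_Cn_on_def by blast
  then have "isCont (\<lambda>z. f (inv_into V \<phi> z)) (\<phi> x)" by (rule has_derivative_continuous)
  moreover have "isCont \<phi> x" using V c(3) by (simp add: continuous_on_eq_continuous_at)
  ultimately have "isCont (\<lambda>y. f (inv_into V \<phi> (\<phi> y))) x" by (rule isCont_o2[rotated])
  moreover have "\<forall>\<^sub>F y in nhds x. f (inv_into V \<phi> (\<phi> y)) = f y"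
    using V(1) c(3) by (auto simp: eventually_nhds is_chart_inv[OF c(2)] intro!: exI[of _ V])
  ultimately show "isCont f x" by (rule isCont_cong[THEN iffD1, rotated])
qed

lemma holomorphic_fun_on_function_algebra:
  assumes "complex_atlas A" "open U"
  shows "function_algebra {f. holomorphic_fun_on A f U} U"
proof
  show "(\<lambda>_. c) \<in> {f. holomorphic_fun_on A f U}" for c
    by (auto simp: holomorphic_fun_on_def holomorphic_Cn_on_const)
  show "(\<lambda>x. f x + g x) \<in> {f. holomorphic_fun_on A f U}"
    if "f \<in> {f. holomorphic_fun_on A f U}" "g \<in> {f. holomorphic_fun_on A f U}" for f g
    using that unfolding holomorphic_fun_on_def by (fast intro: holomorphic_Cn_on_add)
  show "(\<lambda>x. f x * g x) \<in> {f. holomorphic_fun_on A f U}"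
    if "f \<in> {f. holomorphic_fun_on A f U}" "g \<in> {f. holomorphic_fun_on A f U}" for f g
    using that unfolding holomorphic_fun_on_def by (fast intro: holomorphic_Cn_on_mult)
  show "continuous_on U f" if "f \<in> {f. holomorphic_fun_on A f U}" for f
    using that holomorphic_fun_on_continuous[OF assms] by blast
qed

lemma holomorphic_fun_on_locally_uniform_limit:
  fixes A :: "('a::metric_space, 'n::finite) chart set"
  assumes A: "complex_atlas A" and "open U" and s: "\<And>n. holomorphic_fun_on A (s n) U"
    and unif: "\<And>x. x \<in> U \<Longrightarrow> \<exists>W. open W \<and> x \<in> W \<and> W \<subseteq> U \<and> uniform_limit W s f sequentially"
  shows "holomorphic_fun_on A f U"
proof -
  have "holomorphic_Cn_on (\<lambda>z. f (inv_into V \<phi> z)) (\<phi> ` (V \<inter> U))" if c: "(V, \<phi>) \<in> A" for V \<phi>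
  proof (rule holomorphic_Cn_on_uniform_limit)
    have ch: "is_chart (V, \<phi>)" using A c by (auto simp: complex_atlas_def)
    show "holomorphic_Cn_on (\<lambda>z. s n (inv_into V \<phi> z)) (\<phi> ` (V \<inter> U))" for n
      using s[of n] c by (auto simp: holomorphic_fun_on_def)
    fix z assume "z \<in> \<phi> ` (V \<inter> U)"
    then obtain x where x: "x \<in> V" "x \<in> U" "z = \<phi> x" by blast
    obtain W where W: "open W" "x \<in> W" "W \<subseteq> U" "uniform_limit W s f sequentially"
      using unif[OF x(2)] by blast
    have "z \<in> \<phi> ` (V \<inter> W)" using x W(2) by blast
    with is_chart_open_image[OF ch W(1)] obtain r where r: "r > 0" "ball z r \<subseteq> \<phi> ` (V \<inter> W)"
      using open_contains_ball by blast
    have inv: "inv_into V \<phi> y \<in> W" if "y \<in> ball z r" for y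
      using r(2) that is_chart_inv[OF ch] by auto
    have "uniform_limit (ball z r) (\<lambda>n y. s n (inv_into V \<phi> y)) (\<lambda>y. f (inv_into V \<phi> y)) sequentially"
      unfolding uniform_limit_iff
    proof (intro allI impI)
      fix e :: real assume "e > 0"
      with W(4) have "\<forall>\<^sub>F n in sequentially. \<forall>x\<in>W. dist (s n x) (f x) < e" by (rule uniform_limitD)
      then show "\<forall>\<^sub>F n in sequentially. \<forall>y\<in>ball z r. dist (s n (inv_into V \<phi> y)) (f (inv_into V \<phi> y)) < e"
        by (rule eventually_mono) (use inv in blast)
    qed
    moreover have "ball z r \<subseteq> \<phi> ` (V \<inter> U)" using r(2) W(3) by blast
    ultimately show "\<exists>r>0. ball z r \<subseteq> \<phi> ` (V \<inter> U) \<and>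
        uniform_limit (ball z r) (\<lambda>n y. s n (inv_into V \<phi> y)) (\<lambda>y. f (inv_into V \<phi> y)) sequentially"
      using r(1) by blast
  qed
  then show ?thesis unfolding holomorphic_fun_on_def by blast
qed

lemma subset_holomorphic_hull:
  assumes "complex_atlas A" "open U" "compact K" "K \<subseteq> U"
  shows "K \<subseteq> holomorphic_hull A U K"
proof
  fix x assume "x \<in> K"
  interpret function_algebra "{f. holomorphic_fun_on A f U}" U
    using assms by (intro holomorphic_fun_on_function_algebra)
  have "cmod (f x) \<le> (SUP y\<in>K. cmod (f y))" if "holomorphic_fun_on A f U" for f
    using bounded_mem[of f K] assms \<open>x \<in> K\<close> that by (intro cSUP_upper) (auto simp: bdd_above_def)
  then show "x \<in> holomorphic_hull A U K" using \<open>x \<in> K\<close> assms(4) by (auto simp: holomorphic_hull_def)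
qed

lemma holomorphic_hull_mono:
  assumes "complex_atlas A" "open U" "compact L" "L \<subseteq> U" "K \<subseteq> L" "K \<noteq> {}"
  shows "holomorphic_hull A U K \<subseteq> holomorphic_hull A U L"
proof
  fix x assume x: "x \<in> holomorphic_hull A U K"
  interpret function_algebra "{f. holomorphic_fun_on A f U}" U
    using assms by (intro holomorphic_fun_on_function_algebra)
  have "cmod (f x) \<le> (SUP y\<in>L. cmod (f y))" if "holomorphic_fun_on A f U" for f
  proof -
    have "cmod (f x) \<le> (SUP y\<in>K. cmod (f y))" using x that by (auto simp: holomorphic_hull_def)
    also have "\<dots> \<le> (SUP y\<in>L. cmod (f y))"
      using bounded_mem[of f L] assms that by (intro cSUP_subset_mono) (auto simp: bdd_above_def)
    finally show ?thesis .
  qed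
  then show "x \<in> holomorphic_hull A U L" using x by (auto simp: holomorphic_hull_def)
qed

text \<open>Holomorphically convex hulls are holomorphically convex, with \<open>SUP y\<in>K. cmod (f y)\<close> as bound on the hull.\<close>

lemma holomorphic_hull_convex:
  assumes "x \<in> U - holomorphic_hull A U K"
  shows "\<exists>f\<in>{f. holomorphic_fun_on A f U}. \<exists>b. (\<forall>y\<in>holomorphic_hull A U K. cmod (f y) \<le> b) \<and> b < cmod (f x)"
proof -
  obtain f where "holomorphic_fun_on A f U" "(SUP y\<in>K. cmod (f y)) < cmod (f x)"
    using assms by (auto simp: holomorphic_hull_def not_le)
  then show ?thesis
    by (intro bexI[of _ f] exI[of _ "SUP y\<in>K. cmod (f y)"]) (auto simp: holomorphic_hull_def)
qed

section \<open>Boundary values on Stein domains\<close>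

lemma stein_domain_boundary_values:
  fixes A :: "('a::metric_space, 'n::finite) chart set"
    and U S :: "'a set"
    and \<mu> \<nu> :: "'a measure"
    and \<psi> :: "'a \<Rightarrow> complex"
  assumes A: "complex_atlas A" and conn: "connected (UNIV :: 'a set)" and U: "stein_domain A U"
    and \<mu>: "regular_borel_measure_on UNIV \<mu>"
    and \<nu>: "regular_borel_measure_on (frontier U) \<nu>"
    and \<psi>: "\<psi> \<in> borel_measurable (restrict_space borel (frontier U))"
    and S: "closed S" "S \<subseteq> frontier U" "continuous_on S \<psi>"
    and ne: "frontier U \<noteq> {}"
  shows "\<exists>f F. holomorphic_fun_on A f U \<and>
      S \<subseteq> F \<and> F \<subseteq> frontier U \<and> frontier U - F \<in> null_sets \<nu> \<and>
      (\<forall>p\<in>F. \<exists>Fp. Fp \<subseteq> U \<and> Fp \<in> sets \<mu> \<and>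
         (f \<longlongrightarrow> \<psi> p) (at p within Fp) \<and>
         (\<forall>\<epsilon>>0. \<exists>r0>0. \<forall>r. 0 < r \<and> r < r0 \<longrightarrow>
            emeasure \<mu> (ball p r \<inter> (U - Fp)) \<le> ennreal \<epsilon> * emeasure \<mu> (ball p r \<inter> U)))"
proof -
  define \<O> where "\<O> = {f. holomorphic_fun_on A f U}"
  have "open U" "U \<noteq> {}" "U \<noteq> UNIV" using U ne by (auto simp: stein_domain_def)
  then obtain a where "a \<in> U" by blast
  interpret function_algebra \<O> U
    unfolding \<O>_def using A \<open>open U\<close> by (rule holomorphic_fun_on_function_algebra)
  have sep: "\<forall>x\<in>U. \<forall>y\<in>U. x \<noteq> y \<longrightarrow> (\<exists>f\<in>\<O>. f x \<noteq> f y)"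
    using U unfolding stein_domain_def holomorphically_separable_def \<O>_def by blast
  obtain C :: "nat \<Rightarrow> 'a set" where C: "\<And>n. compact (C n)" "\<And>n. C n \<subseteq> interior (C (Suc n))" "(\<Union>n. C n) = UNIV"
    using connected_locally_compact_imp_sigma_compact[OF conn complex_atlas_locally_compact[OF A]] by blast
  obtain D :: "nat \<Rightarrow> 'a set" where D: "\<And>n. compact (D n)" "\<And>n. a \<in> D n" "\<And>n. D n \<subseteq> U"
      "\<And>n. D n \<subseteq> interior (D (Suc n))" "(\<Union>n. D n) = U"
    using open_in_sigma_compact_exhaustion[OF C \<open>open U\<close> \<open>a \<in> U\<close> \<open>U \<noteq> UNIV\<close>] by blast
  have D_Suc: "D n \<subseteq> D (Suc n)" for n using D(4) interior_subset by (rule subset_trans)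
  define H where "H n = holomorphic_hull A U (D n)" for n
  have DH: "D n \<subseteq> H n" for n
    unfolding H_def using A \<open>open U\<close> D(1,3) by (rule subset_holomorphic_hull)
  have H: "compact (H n)" "H n \<subseteq> H (Suc n)" "H n \<subseteq> U" for n
  proof -
    show "compact (H n)" unfolding H_def
      using U D(1,3) by (auto simp: stein_domain_def holomorphically_convex_def)
    show "H n \<subseteq> H (Suc n)" unfolding H_def
      using A \<open>open U\<close> D(1,3) D_Suc by (rule holomorphic_hull_mono) (use D(2) in blast)
    show "H n \<subseteq> U" by (auto simp: H_def holomorphic_hull_def)
  qed
  have H_convex: "\<forall>x\<in>U - H n. \<exists>f\<in>\<O>. \<exists>b. (\<forall>y\<in>H n. cmod (f y) \<le> b) \<and> b < cmod (f x)" for n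
    unfolding H_def \<O>_def by (intro ballI holomorphic_hull_convex)
  have H_exhausts: "\<forall>K. compact K \<longrightarrow> K \<subseteq> U \<longrightarrow> (\<exists>n. K \<subseteq> H n)"
  proof (intro allI impI)
    fix K assume "compact K" "K \<subseteq> U"
    then have "\<exists>n. K \<subseteq> D n" using D(5) by (intro compact_subset_exhaustion D(4)) auto
    then show "\<exists>n. K \<subseteq> H n" using DH by (meson subset_trans)
  qed

  have "C n \<subseteq> C (Suc n)" for n using C(2) interior_subset by (rule subset_trans)
  from Lusin_sigma_compact[OF \<nu> \<psi> frontier_closed C(1) this C(3) S]
  obtain B :: "nat \<Rightarrow> 'a set" where B: "\<And>n. closed (B n)" "\<And>n. S \<subseteq> B n" "\<And>n. B n \<subseteq> frontier U"
      "\<And>n. B n \<subseteq> B (Suc n)" "\<And>n. continuous_on (B n) \<psi>" "frontier U - (\<Union>n. B n) \<in> null_sets \<nu>"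
    by blast
  have "\<exists>g. continuous_on UNIV g \<and> (\<forall>x\<in>B n. g x = \<psi> x)" for n
    using B(1,5) by (rule Tietze_complex)
  then obtain \<Psi> where \<Psi>: "\<And>n. continuous_on UNIV (\<Psi> n)" "\<And>n. \<forall>x\<in>B n. \<Psi> n x = \<psi> x"
    by metis

  note exists_function_with_boundary_values[where C = C and H = H and B = B and \<Psi> = \<Psi>, OF sep \<open>open U\<close> C H H_convex H_exhausts \<mu> B(4,3) \<Psi>]
  then obtain s f where s_mem: "\<forall>n. s n \<in> \<O>"
    and s_unif: "\<forall>K. compact K \<longrightarrow> K \<subseteq> U \<longrightarrow> uniform_limit K s f sequentially"
    and f: "\<forall>p\<in>\<Union>n. B n. \<exists>Fp. Fp \<subseteq> U \<and> Fp \<in> sets \<mu> \<and>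
         (f \<longlongrightarrow> \<psi> p) (at p within Fp) \<and>
         (\<forall>\<epsilon>>0. \<exists>r0>0. \<forall>r. 0 < r \<and> r < r0 \<longrightarrow>
            emeasure \<mu> (ball p r \<inter> (U - Fp)) \<le> ennreal \<epsilon> * emeasure \<mu> (ball p r \<inter> U))"
    by (elim exE conjE) (rule that)
  have "holomorphic_fun_on A f U"
  proof (rule holomorphic_fun_on_locally_uniform_limit[OF A \<open>open U\<close>])
    show "holomorphic_fun_on A (s n) U" for n using s_mem by (simp add: \<O>_def)
    fix x assume "x \<in> U"
    then obtain n where n: "x \<in> D n" using D(5) by blast
    have "uniform_limit (interior (D (Suc n))) s f sequentially"
      using s_unif[rule_format, OF D(1,3)] interior_subset by (rule uniform_limit_on_subset)
    moreover have "x \<in> interior (D (Suc n))" using n D(4) by blast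
    moreover have "interior (D (Suc n)) \<subseteq> U" using interior_subset D(3) by (rule subset_trans)
    ultimately show "\<exists>W. open W \<and> x \<in> W \<and> W \<subseteq> U \<and> uniform_limit W s f sequentially"
      using open_interior by blast
  qed
  moreover have "S \<subseteq> (\<Union>n. B n)" "(\<Union>n. B n) \<subseteq> frontier U" using B(2,3) by blast+
  ultimately show ?thesis using B(6) f by (intro exI[of _ f] exI[of _ "\<Union>n. B n"] conjI)
qed

theorem theorem2:
  fixes A :: "('a::metric_space, 'n::finite) chart set"
    and U S :: "'a set"
    and \<mu> \<nu> :: "'a measure"
    and \<psi> :: "'a \<Rightarrow> complex"
  assumes "complex_manifold A"
    and "stein_domain A U"
    and "regular_borel_measure_on UNIV \<mu>"
    and "regular_borel_measure_on (frontier U) \<nu>"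
    and "\<psi> \<in> borel_measurable (restrict_space borel (frontier U))"
    and "closed S" and "S \<subseteq> frontier U" and "continuous_on S \<psi>"
  shows "\<exists>f F. holomorphic_fun_on A f U \<and>
      S \<subseteq> F \<and> F \<subseteq> frontier U \<and> frontier U - F \<in> null_sets \<nu> \<and>
      (\<forall>p\<in>F. \<exists>Fp. Fp \<subseteq> U \<and> Fp \<in> sets \<mu> \<and>
         (f \<longlongrightarrow> \<psi> p) (at p within Fp) \<and>
         (\<forall>\<epsilon>>0. \<exists>r0>0. \<forall>r. 0 < r \<and> r < r0 \<longrightarrow>
            emeasure \<mu> (ball p r \<inter> (U - Fp)) \<le> ennreal \<epsilon> * emeasure \<mu> (ball p r \<inter> U)))"
proof (cases "frontier U = {}")
  case True
  have "holomorphic_fun_on A (\<lambda>_. 0) U"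
    by (auto simp: holomorphic_fun_on_def holomorphic_Cn_on_const)
  then show ?thesis using True assms(7) by (intro exI[of _ "\<lambda>_. 0"] exI[of _ "{}"]) auto
next
  case False
  \<comment> \<open>The empty atlas of a zero-dimensional manifold is excluded, since \<open>U\<close> would be the whole point.\<close>
  have "\<nexists>p. (UNIV :: 'a set) = {p}"
  proof
    assume "\<exists>p. (UNIV :: 'a set) = {p}"
    then obtain p where "(UNIV :: 'a set) = {p}" by blast
    moreover from this have "U \<subseteq> {p}" using subset_UNIV[of U] by simp
    then have "U = {p}" using assms(2) by (simp add: stein_domain_def subset_singleton_iff)
    ultimately have "U = UNIV" by simp
    then show False using False by simp
  qed
  then have "complex_atlas A" "connected (UNIV :: 'a set)"
    using assms(1) by (auto simp: complex_manifold_def)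
  then show ?thesis using assms(2-) False by (rule stein_domain_boundary_values)
qed

end
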